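(* Let $\gamma>0$ and let $(\varepsilon_d)_{d\in\mathbb{N}}$ be a sequence from $(0,1)$ such that $\varepsilon_d\to0$ as $d\to\infty$. Then $$\ln n(d,\varepsilon_d)=d\cdot\ln\Bigl(1+\frac{c_\omega|\ln\varepsilon_d^2|}{d}\Bigr)+c_\omega|\ln\varepsilon_d^2|\cdot\ln\Bigl(1+\frac{d}{c_\omega|\ln\varepsilon_d^2|}\Bigr)+R_d,\qquad d\to\infty,$$ where $(R_d)_{d\in\mathbb{N}}$ is a sequence such that $$\frac{R_d}{|\ln\varepsilon_d^2|\cdot\ln\Bigl(1+\frac{d}{c_\omega|\ln\varepsilon_d^2|}\Bigr)}\to0,\qquad d\to\infty.$$ Here $n(d,\varepsilon)$ is the worst case information complexity of the $d$-variate approximation problem for the Gaussian kernel with shape parameter $\gamma$.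
   Context: $\mathbb{N}$ is the set of positive integers. Fix a shape parameter $\gamma>0$ (the same for all $d$) and set $$\omega:=\frac{2\gamma^2}{1+2\gamma^2+\sqrt{1+4\gamma^2}}\in(0,1),\qquad c_\omega:=\frac{1}{|\ln\omega|}.$$ For $d\in\mathbb{N}$, $H_{d,\gamma}$ is the (real) reproducing kernel Hilbert space of functions on $\mathbb{R}^d$ with kernel $\mathcal{K}_d(t,s)=\prod_{j=1}^d\exp\{-\gamma^2(t_j-s_j)^2\}$, and $L_{2,d}$ is the space of functions with finite norm $\|f\|_{L_{2,d}}=\bigl(\int_{\mathbb{R}^d}f^2(x)\prod_{j=1}^d\frac{e^{-x_j^2}}{\sqrt{\pi}}\,\mathrm{d}x\bigr)^{1/2}$. The approximation problem is the embedding $\mathrm{APP}_d:H_{d,\gamma}\to L_{2,d}$, $\mathrm{APP}_df=f$. For $n\in\mathbb{N}$ let $\mathcal{A}_{d,n}$ be the class of linear algorithms $A_{d,n}f=\sum_{k=1}^n a_k\,\ell_kf$ with $a_k\in L_{2,d}$ and $\ell_k\in H_{d,\gamma}^*$. Put $$e(d,n)=\inf_{A_{d,n}\in\mathcal{A}_{d,n}}\ \sup_{\|f\|_{H_{d,\gamma}}\le 1}\|\mathrm{APP}_df-A_{d,n}f\|_{L_{2,d}},\qquad e(d,0)=\sup_{\|f\|_{H_{d,\gamma}}\le1}\|f\|_{L_{2,d}}.$$ The worst case information complexity (normalized criterion) is $$n(d,\varepsilon)=\min\{n\in\mathbb{N}: e(d,n)\le\varepsilon\,e(d,0)\},\qquad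 \varepsilon\in(0,1),\ d\in\mathbb{N}.$$ Known facts recalled in the problem setting: $n(d,\varepsilon)=\min\{n\in\mathbb{N}:\lambda_{d,n+1}\le\varepsilon^2\lambda_{d,1}\}$, where $(\lambda_{d,m})_{m\in\mathbb{N}}$ is the non-increasing arrangement (with multiplicity) of the products $\prod_{j=1}^d\lambda_{k_j}$, $k_1,\dots,k_d\in\mathbb{N}$, with $\lambda_k=(1-\omega)\omega^{k-1}$, $k\in\mathbb{N}$. *)

theory Defs
  imports "HOL-Analysis.Analysis"
begin

text \<open>A real-valued function on \<open>X\<close> is represented by its extension by zero to the whole type,
  so that pointwise operations and equality of such functions are those of functions on \<open>X\<close>.\<close>

definition functions_on :: "'a set \<Rightarrow> ('a \<Rightarrow> real) set" where
  "functions_on X = {f. \<forall>t. t \<notin> X \<longrightarrow> f t = 0}"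

definition ip_norm :: "(('a \<Rightarrow> real) \<Rightarrow> ('a \<Rightarrow> real) \<Rightarrow> real) \<Rightarrow> ('a \<Rightarrow> real) \<Rightarrow> real" where
  "ip_norm ip f = sqrt (ip f f)"

locale hilbert_function_space =
  fixes X :: "'a set"
    and H :: "('a \<Rightarrow> real) set"
    and ip :: "('a \<Rightarrow> real) \<Rightarrow> ('a \<Rightarrow> real) \<Rightarrow> real"
  assumes functions_mem: "H \<subseteq> functions_on X"
    and zero_mem: "(\<lambda>t. 0) \<in> H"
    and add_mem: "\<lbrakk>f \<in> H; g \<in> H\<rbrakk> \<Longrightarrow> (\<lambda>t. f t + g t) \<in> H"
    and scale_mem: "f \<in> H \<Longrightarrow> (\<lambda>t. c * f t) \<in> H"
    and ip_commute: "\<lbrakk>f \<in> H; g \<in> H\<rbrakk> \<Longrightarrow> ip f g = ip g f"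
    and ip_add: "\<lbrakk>f \<in> H; g \<in> H; h \<in> H\<rbrakk> \<Longrightarrow> ip (\<lambda>t. f t + g t) h = ip f h + ip g h"
    and ip_scale: "\<lbrakk>f \<in> H; g \<in> H\<rbrakk> \<Longrightarrow> ip (\<lambda>t. c * f t) g = c * ip f g"
    and ip_nonneg: "f \<in> H \<Longrightarrow> 0 \<le> ip f f"
    and ip_eq_zero: "\<lbrakk>f \<in> H; ip f f = 0\<rbrakk> \<Longrightarrow> f = (\<lambda>t. 0)"
    and complete:
      "\<lbrakk>\<And>n :: nat. F n \<in> H;
        \<And>e :: real. 0 < e \<Longrightarrow> \<exists>N. \<forall>m\<ge>N. \<forall>n\<ge>N. ip_norm ip (\<lambda>t. F m t - F n t) < e\<rbrakk>
       \<Longrightarrow> \<exists>f\<in>H. (\<lambda>n. ip_norm ip (\<lambda>t. F n t - f t)) \<longlonglongrightarrow> 0"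

locale rkhs = hilbert_function_space X H ip
  for X :: "'a set"
    and K :: "'a \<Rightarrow> 'a \<Rightarrow> real"
    and H :: "('a \<Rightarrow> real) set"
    and ip :: "('a \<Rightarrow> real) \<Rightarrow> ('a \<Rightarrow> real) \<Rightarrow> real" +
  assumes kernel_mem: "t \<in> X \<Longrightarrow> (\<lambda>s. if s \<in> X then K s t else 0) \<in> H"
    and reproducing: "\<lbrakk>t \<in> X; f \<in> H\<rbrakk> \<Longrightarrow> f t = ip f (\<lambda>s. if s \<in> X then K s t else 0)"

text \<open>The topological dual; functionals are unconstrained outside \<open>H\<close>.\<close>

definition dual_space ::
  "('a \<Rightarrow> real) set \<Rightarrow> (('a \<Rightarrow> real) \<Rightarrow> ('a \<Rightarrow> real) \<Rightarrow> real) \<Rightarrow> (('a \<Rightarrow> real) \<Rightarrow> real) set" where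
  "dual_space H ip = {l.
     (\<forall>f\<in>H. \<forall>g\<in>H. l (\<lambda>t. f t + g t) = l f + l g) \<and>
     (\<forall>f\<in>H. \<forall>c. l (\<lambda>t. c * f t) = c * l f) \<and>
     (\<exists>C. \<forall>f\<in>H. \<bar>l f\<bar> \<le> C * ip_norm ip f)}"

text \<open>Since \<open>d\<close> varies, the points of \<open>\<real>\<^sup>d\<close> are the functions on the index set \<open>{..<d}\<close>,
  extended by \<open>undefined\<close>. This is the space of the product measure \<open>Pi\<^sub>M {..<d} (\<lambda>_. lborel)\<close>,
  which is the \<open>d\<close>-dimensional Lebesgue measure on Borel sets.\<close>

abbreviation Rd :: "nat \<Rightarrow> (nat \<Rightarrow> real) set" where
  "Rd d \<equiv> (\<Pi>\<^sub>E j\<in>{..<d}. UNIV)"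

definition gaussian_kernel :: "real \<Rightarrow> nat \<Rightarrow> (nat \<Rightarrow> real) \<Rightarrow> (nat \<Rightarrow> real) \<Rightarrow> real" where
  "gaussian_kernel \<gamma> d t s = (\<Prod>j<d. exp (- (\<gamma>\<^sup>2 * (t j - s j)\<^sup>2)))"

definition gaussian_measure :: "nat \<Rightarrow> (nat \<Rightarrow> real) measure" where
  "gaussian_measure d =
     density (Pi\<^sub>M {..<d} (\<lambda>_. lborel)) (\<lambda>x. ennreal (\<Prod>j<d. exp (- (x j)\<^sup>2) / sqrt pi))"

definition L2_space :: "nat \<Rightarrow> ((nat \<Rightarrow> real) \<Rightarrow> real) set" where
  "L2_space d = {f \<in> borel_measurable (gaussian_measure d).
                   integrable (gaussian_measure d) (\<lambda>x. (f x)\<^sup>2)}"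

definition L2_norm :: "nat \<Rightarrow> ((nat \<Rightarrow> real) \<Rightarrow> real) \<Rightarrow> real" where
  "L2_norm d f = sqrt (LINT x|gaussian_measure d. (f x)\<^sup>2)"

type_synonym fn = "(nat \<Rightarrow> real) \<Rightarrow> real"

definition linear_algorithms ::
  "fn set \<Rightarrow> (fn \<Rightarrow> fn \<Rightarrow> real) \<Rightarrow> nat \<Rightarrow> nat \<Rightarrow> (fn \<Rightarrow> fn) set" where
  "linear_algorithms H ip d n =
     {(\<lambda>f x. \<Sum>k=1..n. a k x * l k f) | a l.
        \<forall>k\<in>{1..n}. a k \<in> L2_space d \<and> l k \<in> dual_space H ip}"

text \<open>The suprema and infima below are over nonempty bounded sets of reals when \<open>H\<close> is the
  Hilbert space of the Gaussian kernel: its elements are continuous and satisfy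
  \<open>\<bar>f t\<bar> \<le> ip_norm ip f\<close>, and the measure is a probability measure.\<close>

definition worst_case_error ::
  "fn set \<Rightarrow> (fn \<Rightarrow> fn \<Rightarrow> real) \<Rightarrow> nat \<Rightarrow> (fn \<Rightarrow> fn) \<Rightarrow> real" where
  "worst_case_error H ip d A =
     (SUP f\<in>{f \<in> H. ip_norm ip f \<le> 1}. L2_norm d (\<lambda>x. f x - A f x))"

definition minimal_error :: "fn set \<Rightarrow> (fn \<Rightarrow> fn \<Rightarrow> real) \<Rightarrow> nat \<Rightarrow> nat \<Rightarrow> real" where
  "minimal_error H ip d n = (INF A\<in>linear_algorithms H ip d n. worst_case_error H ip d A)"

definition initial_error :: "fn set \<Rightarrow> (fn \<Rightarrow> fn \<Rightarrow> real) \<Rightarrow> nat \<Rightarrow> real" where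
  "initial_error H ip d = (SUP f\<in>{f \<in> H. ip_norm ip f \<le> 1}. L2_norm d f)"

definition info_complexity :: "fn set \<Rightarrow> (fn \<Rightarrow> fn \<Rightarrow> real) \<Rightarrow> nat \<Rightarrow> real \<Rightarrow> nat" where
  "info_complexity H ip d \<epsilon> =
     (LEAST n. 1 \<le> n \<and> minimal_error H ip d n \<le> \<epsilon> * initial_error H ip d)"

definition omega :: "real \<Rightarrow> real" where
  "omega \<gamma> = 2 * \<gamma>\<^sup>2 / (1 + 2 * \<gamma>\<^sup>2 + sqrt (1 + 4 * \<gamma>\<^sup>2))"

definition c_omega :: "real \<Rightarrow> real" where
  "c_omega \<gamma> = 1 / \<bar>ln (omega \<gamma>)\<bar>"

end

theory Submission
  imports Defs "HOL-Probability.Distributions" "HOL-Computational_Algebra.Polynomial"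
begin

text \<open>The embedding of the Gaussian space into the weighted \<open>L\<^sub>2\<close>-space is diagonal in a tensor product
basis. Write \<open>\<gamma>\<^sup>2 = \<delta> (1 + \<delta>)\<close>; then \<open>\<omega> = \<delta> / (1 + \<delta>)\<close>, and completing the square shows that
multiplication by \<open>exp (- \<delta> y\<^sup>2)\<close> turns the integral operator of the univariate kernel into
\<open>1 - \<omega>\<close> times the operator that averages a polynomial over a normal distribution with mean
\<open>\<omega> x\<close>. This operator maps \<open>x\<^sup>n\<close> to \<open>\<omega>\<^sup>n x\<^sup>n\<close> plus lower order terms, so triangularity produces
eigenpolynomials for all eigenvalues \<open>(1 - \<omega>) \<omega>\<^sup>k\<close>. In dimension \<open>d\<close> the eigenvalue of a
multi-index \<open>k\<close> is \<open>(1 - \<omega>)\<^sup>d \<omega>\<close> to the power \<open>\<bar>k\<bar>\<close>.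

The eigenfunctions lie in the reproducing kernel space: the representer of the functional
\<open>f \<mapsto> \<integral> f \<phi>\<^sub>i\<close> is \<open>\<mu>\<^sub>i \<phi>\<^sub>i\<close> (\<open>riesz_representation\<close>, \<open>eigenvector_mem_coeff\<close>). They form a complete
system because the eigenvalues add up to one, which is the trace \<open>\<integral> K(x,x)\<close>: the part of Parseval's
identity that a finite set of eigenfunctions misses is at most the part of the trace that it
misses (\<open>integral_square_le_coeffs\<close>). Consequently \<open>n\<close> functionals cannot do better than the
\<open>n\<close>-term eigenfunction expansion, and \<open>n(d,\<epsilon>)\<close> is the number of eigenvalues above
\<open>\<epsilon>\<^sup>2\<close> times the largest one (\<open>info_complexity_eq_card\<close>). These are the multi-indices with
\<open>\<bar>k\<bar> < x\<close>, where \<open>x = c\<^sub>\<omega> \<bar>ln \<epsilon>\<^sup>2\<bar>\<close>; if \<open>m\<close> is the largest integer below \<open>x\<close>, their number is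
\<open>d + m\<close> choose \<open>d\<close> (\<open>gaussian_info_complexity\<close>).

It remains to compare the logarithm of this binomial coefficient with
\<open>d ln (1 + x / d) + x ln (1 + d / x)\<close>. Stirling-type bounds and the replacement of \<open>m\<close> by \<open>x\<close> cost
at most \<open>1 + ln (min d m) + ln (1 + d / m)\<close>. The reference quantity \<open>x ln (1 + d / x)\<close> is at least
\<open>min d x / 2\<close> and, once \<open>x \<ge> 2\<close>, at least \<open>x / 2\<close> times \<open>ln (1 + d / m)\<close>. Both \<open>d\<close> and \<open>x\<close> tend to infinity,
so the cost is of smaller order (\<open>ln_binomial_asymptotics\<close>).\<close>

section \<open>Hilbert spaces of functions\<close>

text \<open>The common core of the Cauchy-Schwarz inequalities in \<open>H\<close> and in \<open>L\<^sub>2\<close> and of the vanishing of a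
first variation: each time a squared norm is a quadratic polynomial in \<open>t\<close>.\<close>

lemma discriminant_le:
  fixes a b c :: real
  assumes "\<And>t. 0 \<le> a - 2 * t * c + t\<^sup>2 * b" "0 \<le> b"
  shows "c\<^sup>2 \<le> a * b"
proof (cases "b = 0")
  case True
  have "c = 0"
  proof (rule ccontr)
    assume "c \<noteq> 0"
    with assms(1)[of "(a + 1) / (2 * c)"] True show False by simp
  qed
  thus ?thesis using True by simp
next
  case False
  hence "0 < b" using assms by simp
  have "(c / b)\<^sup>2 * b = c * c / b"
    using \<open>0 < b\<close> by (simp add: power2_eq_square)
  hence "c * c / b \<le> a"
    using assms(1)[of "c / b"] by simp
  thus ?thesis using \<open>0 < b\<close> by (simp add: field_simps power2_eq_square)
qed

context hilbert_function_space
begin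

lemma diff_mem: "f \<in> H \<Longrightarrow> g \<in> H \<Longrightarrow> (\<lambda>t. f t - g t) \<in> H"
  using add_mem[of f "\<lambda>t. (-1) * g t"] scale_mem[of g "-1"] by simp

lemma sum_mem:
  assumes "\<And>i. i \<in> S \<Longrightarrow> u i \<in> H"
  shows "(\<lambda>t. \<Sum>i\<in>S. u i t) \<in> H"
  using assms
proof (induction S rule: infinite_finite_induct)
  case (insert i S)
  thus ?case using add_mem[of "u i" "\<lambda>t. \<Sum>i\<in>S. u i t"] by simp
qed (simp_all add: zero_mem)

lemma ip_add_right: "f \<in> H \<Longrightarrow> g \<in> H \<Longrightarrow> h \<in> H \<Longrightarrow> ip h (\<lambda>t. f t + g t) = ip h f + ip h g"
  using ip_add[of f g h] ip_commute add_mem by metis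

lemma ip_scale_right: "f \<in> H \<Longrightarrow> g \<in> H \<Longrightarrow> ip g (\<lambda>t. c * f t) = c * ip g f"
  using ip_scale[of f g c] ip_commute scale_mem by metis

lemma ip_diff:
  assumes "f \<in> H" "g \<in> H" "h \<in> H"
  shows "ip (\<lambda>t. f t - g t) h = ip f h - ip g h"
  using ip_add[of f "\<lambda>t. (-1) * g t" h] ip_scale[of g h "-1"] scale_mem[of g "-1"] assms by simp

lemma ip_diff_right:
  assumes "f \<in> H" "g \<in> H" "h \<in> H"
  shows "ip h (\<lambda>t. f t - g t) = ip h f - ip h g"
  using ip_diff[OF assms] ip_commute assms diff_mem by metis

lemma ip_zero: "h \<in> H \<Longrightarrow> ip (\<lambda>t. 0) h = 0"
  using ip_scale[of h h 0] by simp

lemma ip_sum: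
  assumes "\<And>i. i \<in> S \<Longrightarrow> u i \<in> H" "h \<in> H"
  shows "ip (\<lambda>t. \<Sum>i\<in>S. u i t) h = (\<Sum>i\<in>S. ip (u i) h)"
  using assms(1)
proof (induction S rule: infinite_finite_induct)
  case (insert i S)
  thus ?case
    using ip_add[of "u i" "\<lambda>t. \<Sum>i\<in>S. u i t" h] sum_mem[of S u] assms(2) by simp
qed (simp_all add: ip_zero assms(2))

lemma ip_norm_square: "f \<in> H \<Longrightarrow> (ip_norm ip f)\<^sup>2 = ip f f"
  by (simp add: ip_norm_def ip_nonneg)

lemma ip_norm_nonneg: "f \<in> H \<Longrightarrow> 0 \<le> ip_norm ip f"
  by (simp add: ip_norm_def ip_nonneg)

lemma ip_add_scaled_self:
  assumes "f \<in> H" "h \<in> H"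
  shows "ip (\<lambda>t. f t + c * h t) (\<lambda>t. f t + c * h t) = ip f f + 2 * c * ip f h + c\<^sup>2 * ip h h"
proof -
  have m: "(\<lambda>t. c * h t) \<in> H" "(\<lambda>t. f t + c * h t) \<in> H"
    using assms by (auto intro: add_mem scale_mem)
  show ?thesis
    using assms m ip_commute[OF assms]
    by (simp add: ip_add ip_add_right ip_scale ip_scale_right power2_eq_square algebra_simps)
qed

lemma ip_square_le:
  assumes "f \<in> H" "g \<in> H"
  shows "(ip f g)\<^sup>2 \<le> ip f f * ip g g"
proof (rule discriminant_le)
  fix t :: real
  have "0 \<le> ip (\<lambda>s. f s + (-t) * g s) (\<lambda>s. f s + (-t) * g s)"
    using assms by (intro ip_nonneg add_mem scale_mem)
  also have "\<dots> = ip f f - 2 * t * ip f g + t\<^sup>2 * ip g g"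
    by (subst ip_add_scaled_self[OF assms]) simp
  finally show "0 \<le> ip f f - 2 * t * ip f g + t\<^sup>2 * ip g g" .
qed (use assms ip_nonneg in auto)

lemma ip_abs_le:
  assumes "f \<in> H" "g \<in> H"
  shows "\<bar>ip f g\<bar> \<le> ip_norm ip f * ip_norm ip g"
proof -
  have "\<bar>ip f g\<bar> \<le> sqrt (ip f f * ip g g)"
    by (rule real_le_rsqrt) (use ip_square_le[OF assms] in simp)
  thus ?thesis by (simp add: ip_norm_def real_sqrt_mult)
qed

lemma tendsto_ip:
  assumes F: "\<And>n :: nat. F n \<in> H" and f: "f \<in> H" and h: "h \<in> H"
    and lim: "(\<lambda>n. ip_norm ip (\<lambda>t. F n t - f t)) \<longlonglongrightarrow> 0"
  shows "(\<lambda>n. ip (F n) h) \<longlonglongrightarrow> ip f h"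
proof -
  have "(\<lambda>n. ip (F n) h - ip f h) \<longlonglongrightarrow> 0"
  proof (rule tendsto_0_le[OF lim])
    show "eventually (\<lambda>n. norm (ip (F n) h - ip f h) \<le>
            norm (ip_norm ip (\<lambda>t. F n t - f t)) * ip_norm ip h) sequentially"
    proof (rule always_eventually, rule allI)
      fix n
      have m: "(\<lambda>t. F n t - f t) \<in> H" by (rule diff_mem[OF F f])
      show "norm (ip (F n) h - ip f h) \<le> norm (ip_norm ip (\<lambda>t. F n t - f t)) * ip_norm ip h"
        using ip_abs_le[OF m h] ip_diff[OF F f h] ip_norm_nonneg[OF m] by simp
    qed
  qed
  thus ?thesis by (simp add: LIM_zero_iff)
qed

text \<open>The representer minimises \<open>Q f = ip f f - 2 * l f\<close>. Boundedness of \<open>l\<close> makes \<open>Q\<close> bounded below, the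
parallelogram law makes every minimising sequence a Cauchy sequence, and the vanishing of the
derivative of \<open>Q\<close> at the limit is the claimed identity.\<close>

theorem riesz_representation:
  assumes add: "\<And>f g. f \<in> H \<Longrightarrow> g \<in> H \<Longrightarrow> l (\<lambda>t. f t + g t) = l f + l g"
    and scale: "\<And>f c. f \<in> H \<Longrightarrow> l (\<lambda>t. c * f t) = c * l f"
    and bound: "\<And>f. f \<in> H \<Longrightarrow> \<bar>l f\<bar> \<le> C * ip_norm ip f"
  obtains g where "g \<in> H" "\<And>f. f \<in> H \<Longrightarrow> l f = ip f g"
proof -
  define Q where "Q = (\<lambda>f. ip f f - 2 * l f)"
  have Q_line: "Q (\<lambda>t. f t + c * h t) = Q f + 2 * c * (ip f h - l h) + c\<^sup>2 * ip h h"
    if "f \<in> H" "h \<in> H" for f h c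
    using that add[of f "\<lambda>t. c * h t"] scale[of h c] scale_mem[of h c]
    by (simp add: Q_def ip_add_scaled_self algebra_simps)
  have Q_bound: "- (C\<^sup>2) \<le> Q f" if "f \<in> H" for f
  proof -
    have "0 \<le> (ip_norm ip f - C)\<^sup>2" by simp
    hence "2 * (C * ip_norm ip f) \<le> ip f f + C\<^sup>2"
      using ip_norm_square[OF that] by (simp add: power2_diff algebra_simps)
    thus ?thesis using bound[OF that] by (simp add: Q_def)
  qed
  define m where "m = (INF f\<in>H. Q f)"
  have bdd: "bdd_below (Q ` H)" using Q_bound by (auto intro!: bdd_belowI)
  have m_le: "m \<le> Q f" if "f \<in> H" for f
    unfolding m_def using bdd that by (rule cINF_lower)
  have "\<exists>f\<in>H. Q f < m + 1 / real (Suc n)" for n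
  proof -
    have "m < m + 1 / real (Suc n)" by simp
    thus ?thesis unfolding m_def using cINF_less_iff[OF _ bdd] zero_mem by blast
  qed
  then obtain F where F: "\<And>n. F n \<in> H" and QF: "\<And>n. Q (F n) < m + 1 / real (Suc n)"
    by metis
  \<comment> \<open>parallelogram law: near-minimisers of \<open>Q\<close> are close to each other\<close>
  have near: "ip (\<lambda>t. f t - g t) (\<lambda>t. f t - g t) \<le> 2 * ((Q f - m) + (Q g - m))"
    if "f \<in> H" "g \<in> H" for f g
  proof -
    define h where "h = (\<lambda>t. g t - f t)"
    have h: "h \<in> H" unfolding h_def by (rule diff_mem[OF that(2,1)])
    have g: "(\<lambda>t. f t + 1 * h t) = g" by (simp add: h_def)
    have d: "(\<lambda>t. f t - g t) = (\<lambda>t. (-1) * h t)" by (simp add: h_def)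
    have "Q g = Q f + 2 * (ip f h - l h) + ip h h"
      using Q_line[OF that(1) h, of 1] unfolding g by simp
    moreover have "m \<le> Q f + (ip f h - l h) + ip h h / 4"
      using Q_line[OF that(1) h, of "1/2"] m_le[OF add_mem[OF that(1) scale_mem[OF h, of "1/2"]]]
      by (simp add: power2_eq_square)
    moreover have "ip (\<lambda>t. f t - g t) (\<lambda>t. f t - g t) = ip h h"
      unfolding d using h scale_mem[OF h, of "-1"] by (simp only: ip_scale ip_scale_right)
    moreover define N where "N = ip h h"
    ultimately show ?thesis by (simp add: algebra_simps)
  qed
  have "\<exists>N. \<forall>m\<ge>N. \<forall>n\<ge>N. ip_norm ip (\<lambda>t. F m t - F n t) < e" if "0 < e" for e :: real
  proof -
    obtain N :: nat where N: "4 / e\<^sup>2 < real (Suc N)"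
      using reals_Archimedean2[of "4 / e\<^sup>2"] by (metis less_SucI of_nat_less_iff order_less_trans lessI)
    have small: "Q (F n) - m < 1 / real (Suc N)" if "N \<le> n" for n
    proof -
      have "1 / real (Suc n) \<le> 1 / real (Suc N)" using that by (intro divide_left_mono) auto
      thus ?thesis using QF[of n] by linarith
    qed
    have "ip_norm ip (\<lambda>t. F p t - F q t) < e" if "N \<le> p" "N \<le> q" for p q
    proof -
      have "ip (\<lambda>t. F p t - F q t) (\<lambda>t. F p t - F q t) < 4 / real (Suc N)"
        using near[OF F F, of p q] small[OF that(1)] small[OF that(2)] by simp
      also have "\<dots> < e\<^sup>2" using N \<open>0 < e\<close> by (simp add: field_simps)
      finally show ?thesis
        using \<open>0 < e\<close> real_sqrt_less_mono[of _ "e\<^sup>2"] by (simp add: ip_norm_def)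
    qed
    thus ?thesis by blast
  qed
  from complete[OF F this] obtain g where g: "g \<in> H"
    and lim: "(\<lambda>n. ip_norm ip (\<lambda>t. F n t - g t)) \<longlonglongrightarrow> 0"
    by blast
  have "l h = ip h g" if h: "h \<in> H" for h
  proof -
    define b where "b = ip g h - l h"
    \<comment> \<open>first variation of \<open>Q\<close> at the minimiser\<close>
    have var: "0 \<le> 2 * c * b + c\<^sup>2 * ip h h" for c
    proof (rule LIMSEQ_le)
      show "(\<lambda>n. - (1 / real (Suc n))) \<longlonglongrightarrow> 0"
        using tendsto_minus[OF LIMSEQ_inverse_real_of_nat] by (simp add: inverse_eq_divide)
      show "(\<lambda>n. 2 * c * (ip (F n) h - l h) + c\<^sup>2 * ip h h) \<longlonglongrightarrow> 2 * c * b + c\<^sup>2 * ip h h"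
        unfolding b_def by (intro tendsto_intros tendsto_ip[OF F g h lim])
      show "\<exists>N. \<forall>n\<ge>N. - (1 / real (Suc n)) \<le> 2 * c * (ip (F n) h - l h) + c\<^sup>2 * ip h h"
      proof (intro exI[of _ 0] allI impI)
        fix n
        have "m \<le> Q (F n) + 2 * c * (ip (F n) h - l h) + c\<^sup>2 * ip h h"
          using m_le[OF add_mem[OF F scale_mem[OF h]]] Q_line[OF F h] by metis
        thus "- (1 / real (Suc n)) \<le> 2 * c * (ip (F n) h - l h) + c\<^sup>2 * ip h h"
          using QF[of n] by linarith
      qed
    qed
    have "b\<^sup>2 \<le> 0 * ip h h"
    proof (rule discriminant_le)
      show "0 \<le> 0 - 2 * t * b + t\<^sup>2 * ip h h" for t using var[of "-t"] by simp
    qed (rule ip_nonneg[OF h])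
    hence "b = 0" by simp
    thus ?thesis using ip_commute[OF g h] by (simp add: b_def)
  qed
  thus ?thesis using that g by blast
qed

text \<open>Pythagoras for a system that is orthogonal but not normalised. The coefficients \<open>a\<close> are left
free because the identity serves both for the expansion of an element of \<open>H\<close> and for the expansion
of a kernel section.\<close>

lemma ip_residual_orthogonal:
  assumes S: "finite S" and u: "\<And>i. i \<in> S \<Longrightarrow> u i \<in> H" and f: "f \<in> H"
    and orth: "\<And>i j. i \<in> S \<Longrightarrow> j \<in> S \<Longrightarrow> ip (u i) (u j) = (if i = j then w i else 0)"
  shows "ip (\<lambda>t. f t - (\<Sum>i\<in>S. a i * u i t)) (\<lambda>t. f t - (\<Sum>i\<in>S. a i * u i t)) =
           ip f f - 2 * (\<Sum>i\<in>S. a i * ip f (u i)) + (\<Sum>i\<in>S. (a i)\<^sup>2 * w i)"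
proof -
  define p where "p = (\<lambda>t. \<Sum>i\<in>S. a i * u i t)"
  have p: "p \<in> H" unfolding p_def using u by (intro sum_mem scale_mem)
  have ip_p: "ip p h = (\<Sum>i\<in>S. a i * ip (u i) h)" if "h \<in> H" for h
  proof -
    have "ip p h = (\<Sum>i\<in>S. ip (\<lambda>t. a i * u i t) h)"
      unfolding p_def using u that by (intro ip_sum scale_mem)
    also have "\<dots> = (\<Sum>i\<in>S. a i * ip (u i) h)"
      using u that by (intro sum.cong) (auto simp: ip_scale)
    finally show ?thesis .
  qed
  have pf: "ip p f = (\<Sum>i\<in>S. a i * ip f (u i))"
    unfolding ip_p[OF f] using u f by (intro sum.cong refl) (metis ip_commute)
  have "ip p p = (\<Sum>i\<in>S. a i * ip p (u i))"
    unfolding ip_p[OF p] using u p by (intro sum.cong refl) (metis ip_commute)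
  also have "\<dots> = (\<Sum>i\<in>S. (a i)\<^sup>2 * w i)"
  proof (intro sum.cong refl)
    fix i assume i: "i \<in> S"
    have "ip p (u i) = (\<Sum>j\<in>S. if j = i then a j * w j else 0)"
      unfolding ip_p[OF u[OF i]] using i orth by (intro sum.cong) auto
    also have "\<dots> = a i * w i" using S i by simp
    finally show "a i * ip p (u i) = (a i)\<^sup>2 * w i" by (simp add: power2_eq_square)
  qed
  finally have pp: "ip p p = (\<Sum>i\<in>S. (a i)\<^sup>2 * w i)" .
  have "ip (\<lambda>t. f t + (-1) * p t) (\<lambda>t. f t + (-1) * p t) = ip f f - 2 * ip f p + ip p p"
    by (subst ip_add_scaled_self[OF f p]) simp
  moreover have "(\<lambda>t. f t - (\<Sum>i\<in>S. a i * u i t)) = (\<lambda>t. f t + (-1) * p t)"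
    by (simp add: p_def)
  ultimately show ?thesis using pf pp ip_commute[OF f p] by simp
qed

end

section \<open>Kernels with an orthonormal system of eigenfunctions\<close>

definition square_integrable :: "'a measure \<Rightarrow> ('a \<Rightarrow> real) \<Rightarrow> bool" where
  "square_integrable M f \<longleftrightarrow> f \<in> borel_measurable M \<and> integrable M (\<lambda>x. (f x)\<^sup>2)"

lemma square_integrable_mult:
  assumes "square_integrable M f" "square_integrable M g"
  shows "integrable M (\<lambda>x. f x * g x)"
proof (rule Bochner_Integration.integrable_bound)
  show "integrable M (\<lambda>x. (f x)\<^sup>2 + (g x)\<^sup>2)"
    using assms by (auto simp: square_integrable_def)
  have "\<bar>a * b\<bar> \<le> a\<^sup>2 + b\<^sup>2" for a b :: real
  proof -
    have "0 \<le> (\<bar>a\<bar> - \<bar>b\<bar>)\<^sup>2" by simp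
    hence "2 * \<bar>a * b\<bar> \<le> a\<^sup>2 + b\<^sup>2" by (simp add: power2_diff abs_mult)
    moreover have "0 \<le> \<bar>a * b\<bar>" by simp
    ultimately show ?thesis by linarith
  qed
  thus "AE x in M. norm (f x * g x) \<le> norm ((f x)\<^sup>2 + (g x)\<^sup>2)"
    by (intro AE_I2) simp
qed (use assms in \<open>auto simp: square_integrable_def\<close>)

lemma integral_diff_square:
  assumes "square_integrable M f" "square_integrable M g"
  shows "(\<integral>x. (f x - g x)\<^sup>2 \<partial>M) =
           (\<integral>x. (f x)\<^sup>2 \<partial>M) - 2 * (\<integral>x. f x * g x \<partial>M) + (\<integral>x. (g x)\<^sup>2 \<partial>M)"
proof -
  have "(\<integral>x. (f x - g x)\<^sup>2 \<partial>M) = (\<integral>x. ((f x)\<^sup>2 - 2 * (f x * g x)) + (g x)\<^sup>2 \<partial>M)"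
    by (intro Bochner_Integration.integral_cong refl) (simp add: power2_diff)
  also have "\<dots> = (\<integral>x. (f x)\<^sup>2 \<partial>M) - 2 * (\<integral>x. f x * g x \<partial>M) + (\<integral>x. (g x)\<^sup>2 \<partial>M)"
    using assms square_integrable_mult[OF assms] by (simp add: square_integrable_def)
  finally show ?thesis .
qed

lemma square_integrable_scale:
  "square_integrable M f \<Longrightarrow> square_integrable M (\<lambda>x. c * f x)"
  by (auto simp: square_integrable_def power_mult_distrib)

lemma integral_mult_square_le:
  assumes "square_integrable M f" "square_integrable M g"
  shows "(\<integral>x. f x * g x \<partial>M)\<^sup>2 \<le> (\<integral>x. (f x)\<^sup>2 \<partial>M) * (\<integral>x. (g x)\<^sup>2 \<partial>M)"
proof (rule discriminant_le)
  fix t :: real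
  have "0 \<le> (\<integral>x. (f x - t * g x)\<^sup>2 \<partial>M)" by simp
  also have "\<dots> = (\<integral>x. (f x)\<^sup>2 \<partial>M) - 2 * t * (\<integral>x. f x * g x \<partial>M) + t\<^sup>2 * (\<integral>x. (g x)\<^sup>2 \<partial>M)"
    by (subst integral_diff_square[OF assms(1) square_integrable_scale[OF assms(2)]])
      (simp add: power_mult_distrib mult.left_commute)
  finally show "0 \<le> (\<integral>x. (f x)\<^sup>2 \<partial>M) - 2 * t * (\<integral>x. f x * g x \<partial>M) + t\<^sup>2 * (\<integral>x. (g x)\<^sup>2 \<partial>M)" .
qed simp

context rkhs
begin

definition kern :: "'a \<Rightarrow> 'a \<Rightarrow> real" where
  "kern x = (\<lambda>s. if s \<in> X then K s x else 0)"

lemma kern_mem: "x \<in> X \<Longrightarrow> kern x \<in> H"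
  unfolding kern_def by (rule kernel_mem)

lemma eval_eq: "x \<in> X \<Longrightarrow> f \<in> H \<Longrightarrow> f x = ip f (kern x)"
  unfolding kern_def by (rule reproducing)

lemma ip_kern_self: "x \<in> X \<Longrightarrow> ip (kern x) (kern x) = K x x"
  using eval_eq[of x "kern x"] kern_mem[of x] by (simp add: kern_def)

lemma eval_square_le: "x \<in> X \<Longrightarrow> f \<in> H \<Longrightarrow> (f x)\<^sup>2 \<le> ip f f * K x x"
  using ip_square_le[of f "kern x"] kern_mem eval_eq ip_kern_self by metis

text \<open>The distance of two kernel sections in \<open>H\<close> is a modulus of continuity for the elements of \<open>H\<close>.\<close>

lemma eval_diff_square_le:
  assumes "s \<in> X" "t \<in> X" "f \<in> H"
  shows "(f s - f t)\<^sup>2 \<le> ip f f * (K s s - 2 * K t s + K t t)"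
proof -
  have m: "kern s \<in> H" "kern t \<in> H" "(\<lambda>x. kern s x - kern t x) \<in> H"
    using assms by (auto intro: kern_mem diff_mem)
  have "f s - f t = ip f (\<lambda>x. kern s x - kern t x)"
    using eval_eq assms m by (simp add: ip_diff_right)
  moreover have "ip (\<lambda>x. kern s x - kern t x) (\<lambda>x. kern s x - kern t x) =
      ip (kern s) (kern s) - 2 * ip (kern s) (kern t) + ip (kern t) (kern t)"
    using m by (simp add: ip_diff ip_diff_right ip_commute[of "kern t" "kern s"])
  moreover have "ip (kern s) (kern t) = K t s"
    using eval_eq[of t "kern s"] assms m by (simp add: kern_def)
  ultimately show ?thesis
    using ip_square_le[OF assms(3) m(3)] ip_kern_self assms by simp
qed

end

text \<open>The eigenfunctions are normalised in \<open>L\<^sub>2(M)\<close>. The assumption \<open>trace\<close> says that the eigenvalues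
exhaust the trace of the integral operator; this is the form in which the completeness of the
system enters.\<close>

locale kernel_eigensystem = rkhs X K H ip
  for X :: "'a set" and K H ip +
  fixes M :: "'a measure" and I :: "'i set" and \<phi> :: "'i \<Rightarrow> 'a \<Rightarrow> real" and \<mu> :: "'i \<Rightarrow> real"
  assumes space_M: "space M = X"
    and mem_measurable: "f \<in> H \<Longrightarrow> f \<in> borel_measurable M"
    and diagonal_integrable: "integrable M (\<lambda>x. K x x)"
    and eigenfunction_square_integrable: "i \<in> I \<Longrightarrow> square_integrable M (\<phi> i)"
    and eigenfunctions_orthonormal:
      "i \<in> I \<Longrightarrow> j \<in> I \<Longrightarrow> (\<integral>x. \<phi> i x * \<phi> j x \<partial>M) = (if i = j then 1 else 0)"
    and eigenvalue_pos: "i \<in> I \<Longrightarrow> 0 < \<mu> i"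
    and eigenfunction: "i \<in> I \<Longrightarrow> x \<in> X \<Longrightarrow> (\<integral>y. K y x * \<phi> i y \<partial>M) = \<mu> i * \<phi> i x"
    and trace: "0 < e \<Longrightarrow> \<exists>F. finite F \<and> F \<subseteq> I \<and> (\<integral>x. K x x \<partial>M) - e \<le> (\<Sum>i\<in>F. \<mu> i)"
begin

lemma mem_square_integrable:
  assumes "f \<in> H"
  shows "square_integrable M f"
  unfolding square_integrable_def
proof
  show "f \<in> borel_measurable M" by (rule mem_measurable[OF assms])
  thus "integrable M (\<lambda>x. (f x)\<^sup>2)"
    by (intro Bochner_Integration.integrable_bound[OF integrable_mult_right[OF diagonal_integrable, of "ip f f"]])
      (use eval_square_le[OF _ assms] space_M in \<open>auto intro!: AE_I2 order_trans[OF _ abs_ge_self]\<close>)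
qed

lemma integral_square_le_trace:
  assumes "f \<in> H"
  shows "(\<integral>x. (f x)\<^sup>2 \<partial>M) \<le> ip f f * (\<integral>x. K x x \<partial>M)"
proof -
  have "(\<integral>x. (f x)\<^sup>2 \<partial>M) \<le> (\<integral>x. ip f f * K x x \<partial>M)"
    using mem_square_integrable[OF assms] diagonal_integrable eval_square_le[OF _ assms] space_M
    by (intro integral_mono) (auto simp: square_integrable_def)
  thus ?thesis by simp
qed

definition coeff :: "('a \<Rightarrow> real) \<Rightarrow> 'i \<Rightarrow> real" where
  "coeff f i = (\<integral>x. f x * \<phi> i x \<partial>M)"

definition eigenvector :: "'i \<Rightarrow> 'a \<Rightarrow> real" where
  "eigenvector i = (\<lambda>x. if x \<in> X then \<phi> i x else 0)"

text \<open>By Cauchy-Schwarz in \<open>L\<^sub>2\<close>, because the \<open>L\<^sub>2\<close>-norm is dominated by the norm of \<open>H\<close>. These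
functionals are the information used by the optimal algorithm.\<close>

lemma coeff_dual:
  assumes "i \<in> I"
  shows "(\<lambda>f. coeff f i) \<in> dual_space H ip"
proof -
  note \<phi> = eigenfunction_square_integrable[OF assms]
  have add: "coeff (\<lambda>t. f t + g t) i = coeff f i + coeff g i" if "f \<in> H" "g \<in> H" for f g
    using square_integrable_mult[OF mem_square_integrable \<phi>] that
    by (simp add: coeff_def distrib_right)
  have scale: "coeff (\<lambda>t. c * f t) i = c * coeff f i" for f c
    by (simp add: coeff_def mult.assoc)
  have bound: "\<bar>coeff f i\<bar> \<le> sqrt (\<integral>x. K x x \<partial>M) * ip_norm ip f" if f: "f \<in> H" for f
  proof -
    have "(coeff f i)\<^sup>2 \<le> (\<integral>x. (f x)\<^sup>2 \<partial>M) * (\<integral>x. (\<phi> i x)\<^sup>2 \<partial>M)"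
      unfolding coeff_def by (rule integral_mult_square_le[OF mem_square_integrable[OF f] \<phi>])
    also have "\<dots> = (\<integral>x. (f x)\<^sup>2 \<partial>M)"
      using eigenfunctions_orthonormal[OF assms assms] by (simp add: power2_eq_square)
    also have "\<dots> \<le> (\<integral>x. K x x \<partial>M) * ip f f"
      using integral_square_le_trace[OF f] by (simp add: mult.commute)
    finally have "\<bar>coeff f i\<bar> \<le> sqrt ((\<integral>x. K x x \<partial>M) * ip f f)"
      by (intro real_le_rsqrt) simp
    thus ?thesis by (simp add: real_sqrt_mult ip_norm_def)
  qed
  show ?thesis
    unfolding dual_space_def using add scale bound by blast
qed

text \<open>The functional \<open>coeff\<close> has a Riesz representer, and evaluating the representer at \<open>x\<close> means
applying the functional to the kernel section at \<open>x\<close>. By the eigenvalue equation the result is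
\<open>\<mu> i * \<phi> i x\<close>. So the eigenfunctions belong to \<open>H\<close>, and their coefficients in \<open>H\<close> and in \<open>L\<^sub>2\<close> agree
up to the factor \<open>\<mu> i\<close>.\<close>

lemma eigenvector_mem_coeff:
  assumes i: "i \<in> I"
  shows "eigenvector i \<in> H \<and> (\<forall>f\<in>H. ip f (eigenvector i) = coeff f i / \<mu> i)"
proof -
  have dual: "(\<forall>f\<in>H. \<forall>g\<in>H. coeff (\<lambda>t. f t + g t) i = coeff f i + coeff g i) \<and>
     (\<forall>f\<in>H. \<forall>c. coeff (\<lambda>t. c * f t) i = c * coeff f i) \<and>
     (\<exists>C. \<forall>f\<in>H. \<bar>coeff f i\<bar> \<le> C * ip_norm ip f)"
    using coeff_dual[OF i] by (simp add: dual_space_def)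
  then obtain C where "\<And>f. f \<in> H \<Longrightarrow> \<bar>coeff f i\<bar> \<le> C * ip_norm ip f" by blast
  with dual obtain g where g: "g \<in> H" and repr: "\<And>f. f \<in> H \<Longrightarrow> coeff f i = ip f g"
    by (auto intro: riesz_representation[of "\<lambda>f. coeff f i" C])
  have "g x = \<mu> i * \<phi> i x" if x: "x \<in> X" for x
  proof -
    have "g x = coeff (kern x) i"
      using eval_eq[OF x g] repr[OF kern_mem[OF x]] ip_commute[OF g kern_mem[OF x]] by simp
    also have "\<dots> = (\<integral>y. K y x * \<phi> i y \<partial>M)"
      unfolding coeff_def kern_def
      by (intro Bochner_Integration.integral_cong refl) (simp add: space_M)
    finally show ?thesis using eigenfunction[OF i x] by simp
  qed
  moreover have "g x = 0" if "x \<notin> X" for x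
    using g functions_mem that by (auto simp: functions_on_def)
  ultimately have eq: "eigenvector i = (\<lambda>x. (1 / \<mu> i) * g x)"
    using eigenvalue_pos[OF i] by (auto simp: eigenvector_def fun_eq_iff)
  have "ip f (\<lambda>x. (1 / \<mu> i) * g x) = coeff f i / \<mu> i" if "f \<in> H" for f
    unfolding ip_scale_right[OF g that] repr[OF that] by simp
  thus ?thesis
    unfolding eq using scale_mem[OF g] by blast
qed

lemmas eigenvector_mem = eigenvector_mem_coeff[THEN conjunct1]

lemma ip_eigenvector: "i \<in> I \<Longrightarrow> f \<in> H \<Longrightarrow> ip f (eigenvector i) = coeff f i / \<mu> i"
  using eigenvector_mem_coeff by blast

lemma integral_eigenvectors:
  assumes "i \<in> I" "j \<in> I"
  shows "(\<integral>x. eigenvector i x * eigenvector j x \<partial>M) = (if i = j then 1 else 0)"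
  unfolding eigenfunctions_orthonormal[OF assms, symmetric]
  by (intro Bochner_Integration.integral_cong) (auto simp: space_M eigenvector_def)

lemma coeff_eq_eigenvector: "coeff f i = (\<integral>x. f x * eigenvector i x \<partial>M)"
  unfolding coeff_def by (intro Bochner_Integration.integral_cong) (auto simp: space_M eigenvector_def)

lemma coeff_eigenvector: "i \<in> I \<Longrightarrow> j \<in> I \<Longrightarrow> coeff (eigenvector i) j = (if i = j then 1 else 0)"
  by (simp add: coeff_eq_eigenvector integral_eigenvectors)

lemma ip_eigenvectors:
  "i \<in> I \<Longrightarrow> j \<in> I \<Longrightarrow> ip (eigenvector i) (eigenvector j) = (if i = j then 1 / \<mu> i else 0)"
  by (simp add: ip_eigenvector eigenvector_mem coeff_eigenvector)

lemma bessel: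
  assumes F: "finite F" "F \<subseteq> I" and f: "f \<in> H"
  shows "(\<Sum>i\<in>F. (coeff f i)\<^sup>2 / \<mu> i) \<le> ip f f"
proof -
  have u: "eigenvector i \<in> H" if "i \<in> F" for i using that F eigenvector_mem by blast
  have "0 \<le> ip (\<lambda>t. f t - (\<Sum>i\<in>F. coeff f i * eigenvector i t))
               (\<lambda>t. f t - (\<Sum>i\<in>F. coeff f i * eigenvector i t))"
    using u by (intro ip_nonneg diff_mem f sum_mem scale_mem)
  also have "\<dots> = ip f f - 2 * (\<Sum>i\<in>F. coeff f i * ip f (eigenvector i))
                 + (\<Sum>i\<in>F. (coeff f i)\<^sup>2 * (1 / \<mu> i))"
    using F u f by (intro ip_residual_orthogonal) (auto simp: ip_eigenvectors subset_iff)
  also have "(\<Sum>i\<in>F. coeff f i * ip f (eigenvector i)) = (\<Sum>i\<in>F. (coeff f i)\<^sup>2 / \<mu> i)"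
    using F f by (intro sum.cong) (auto simp: ip_eigenvector power2_eq_square subset_iff)
  finally show ?thesis by simp
qed

lemma integral_residual_square:
  assumes F: "finite F" "F \<subseteq> I" and f: "f \<in> H"
  shows "(\<integral>x. (f x - (\<Sum>i\<in>F. coeff f i * eigenvector i x))\<^sup>2 \<partial>M) =
           (\<integral>x. (f x)\<^sup>2 \<partial>M) - (\<Sum>i\<in>F. (coeff f i)\<^sup>2)"
proof -
  let ?p = "\<lambda>x. \<Sum>i\<in>F. coeff f i * eigenvector i x"
  have u: "eigenvector i \<in> H" if "i \<in> F" for i using that F eigenvector_mem by blast
  have p: "?p \<in> H" using u by (intro sum_mem scale_mem)
  have inner: "(\<integral>x. g x * ?p x \<partial>M) = (\<Sum>i\<in>F. coeff f i * coeff g i)" if g: "g \<in> H" for g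
  proof -
    have "(\<integral>x. g x * ?p x \<partial>M) = (\<integral>x. (\<Sum>i\<in>F. coeff f i * (g x * eigenvector i x)) \<partial>M)"
      by (intro Bochner_Integration.integral_cong refl) (simp add: sum_distrib_left mult_ac)
    also have "\<dots> = (\<Sum>i\<in>F. \<integral>x. coeff f i * (g x * eigenvector i x) \<partial>M)"
      using g u by (intro Bochner_Integration.integral_sum integrable_mult_right square_integrable_mult mem_square_integrable)
    also have "\<dots> = (\<Sum>i\<in>F. coeff f i * coeff g i)"
      by (simp add: coeff_eq_eigenvector)
    finally show ?thesis .
  qed
  have "coeff ?p i = coeff f i" if i: "i \<in> F" for i
  proof -
    have "coeff ?p i = (\<integral>x. eigenvector i x * ?p x \<partial>M)"
      by (simp add: coeff_eq_eigenvector mult.commute)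
    also have "\<dots> = (\<Sum>j\<in>F. coeff f j * coeff (eigenvector i) j)" by (rule inner[OF u[OF i]])
    also have "\<dots> = (\<Sum>j\<in>F. if j = i then coeff f j else 0)"
      using F i by (intro sum.cong refl) (auto simp: coeff_eigenvector subset_iff)
    also have "\<dots> = coeff f i" using F i by simp
    finally show ?thesis .
  qed
  hence "(\<integral>x. (?p x)\<^sup>2 \<partial>M) = (\<Sum>i\<in>F. (coeff f i)\<^sup>2)"
    using inner[OF p] by (simp add: power2_eq_square)
  moreover have "(\<integral>x. f x * ?p x \<partial>M) = (\<Sum>i\<in>F. (coeff f i)\<^sup>2)"
    using inner[OF f] by (simp add: power2_eq_square)
  ultimately show ?thesis
    using integral_diff_square[OF mem_square_integrable[OF f] mem_square_integrable[OF p]] by simp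
qed

text \<open>The residual of \<open>f\<close> at \<open>x\<close> is the inner product of \<open>f\<close> with the residual of the kernel section at
\<open>x\<close>, and the second factor on the right is the squared norm of the latter.\<close>

lemma residual_square_le:
  assumes F: "finite F" "F \<subseteq> I" and f: "f \<in> H" and x: "x \<in> X"
  shows "(f x - (\<Sum>i\<in>F. coeff f i * eigenvector i x))\<^sup>2
           \<le> ip f f * (K x x - (\<Sum>i\<in>F. \<mu> i * (\<phi> i x)\<^sup>2))"
proof -
  have u: "eigenvector i \<in> H" if "i \<in> F" for i using that F eigenvector_mem by blast
  let ?a = "\<lambda>i. \<mu> i * \<phi> i x"
  let ?p = "\<lambda>t. \<Sum>i\<in>F. ?a i * eigenvector i t"
  have kx: "ip (kern x) (eigenvector i) = \<phi> i x" if "i \<in> F" for i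
    using eval_eq[OF x u[OF that]] ip_commute[OF u[OF that] kern_mem[OF x]] x
    by (simp add: eigenvector_def)
  have p: "?p \<in> H" using u by (intro sum_mem scale_mem)
  have "ip f ?p = ip ?p f" by (rule ip_commute[OF f p])
  also have "\<dots> = (\<Sum>i\<in>F. ip (\<lambda>t. ?a i * eigenvector i t) f)"
    using u f by (intro ip_sum scale_mem)
  also have "\<dots> = (\<Sum>i\<in>F. coeff f i * eigenvector i x)"
  proof (intro sum.cong refl)
    fix i assume i: "i \<in> F"
    hence "i \<in> I" using F by blast
    have "ip (\<lambda>t. ?a i * eigenvector i t) f = ?a i * ip f (eigenvector i)"
      using ip_scale[OF u[OF i] f] ip_commute[OF u[OF i] f] by simp
    thus "ip (\<lambda>t. ?a i * eigenvector i t) f = coeff f i * eigenvector i x"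
      using ip_eigenvector[OF \<open>i \<in> I\<close> f] eigenvalue_pos[OF \<open>i \<in> I\<close>] x by (simp add: eigenvector_def)
  qed
  finally have residual: "f x - (\<Sum>i\<in>F. coeff f i * eigenvector i x) = ip f (\<lambda>t. kern x t - ?p t)"
    using ip_diff_right[OF kern_mem[OF x] p f] eval_eq[OF x f] by simp
  have le: "(ip f (\<lambda>t. kern x t - ?p t))\<^sup>2
              \<le> ip f f * ip (\<lambda>t. kern x t - ?p t) (\<lambda>t. kern x t - ?p t)"
    by (intro ip_square_le f diff_mem kern_mem x p)
  have sum1: "(\<Sum>i\<in>F. ?a i * ip (kern x) (eigenvector i)) = (\<Sum>i\<in>F. \<mu> i * (\<phi> i x)\<^sup>2)"
    by (intro sum.cong refl) (simp add: kx power2_eq_square)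
  have sum2: "(\<Sum>i\<in>F. (?a i)\<^sup>2 * (1 / \<mu> i)) = (\<Sum>i\<in>F. \<mu> i * (\<phi> i x)\<^sup>2)"
  proof (intro sum.cong refl)
    fix i assume "i \<in> F"
    hence "0 < \<mu> i" using F eigenvalue_pos by blast
    thus "(?a i)\<^sup>2 * (1 / \<mu> i) = \<mu> i * (\<phi> i x)\<^sup>2" by (simp add: power2_eq_square)
  qed
  have "ip (\<lambda>t. kern x t - ?p t) (\<lambda>t. kern x t - ?p t) =
      ip (kern x) (kern x) - 2 * (\<Sum>i\<in>F. ?a i * ip (kern x) (eigenvector i))
        + (\<Sum>i\<in>F. (?a i)\<^sup>2 * (1 / \<mu> i))"
  proof (rule ip_residual_orthogonal[OF F(1) _ kern_mem[OF x]])
    show "ip (eigenvector i) (eigenvector j) = (if i = j then 1 / \<mu> i else 0)"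
      if "i \<in> F" "j \<in> F" for i j
      using that F(2) by (intro ip_eigenvectors) auto
  qed (rule u)
  hence "ip (\<lambda>t. kern x t - ?p t) (\<lambda>t. kern x t - ?p t) = K x x - (\<Sum>i\<in>F. \<mu> i * (\<phi> i x)\<^sup>2)"
    unfolding sum1 sum2 ip_kern_self[OF x] by simp
  thus ?thesis using le residual by simp
qed

text \<open>The pointwise estimate, integrated: the defect in Parseval's identity is controlled by the defect
in the trace, uniformly on the unit ball of \<open>H\<close>.\<close>

lemma integral_square_le_coeffs:
  assumes F: "finite F" "F \<subseteq> I" and f: "f \<in> H"
  shows "(\<integral>x. (f x)\<^sup>2 \<partial>M) \<le>
    (\<Sum>i\<in>F. (coeff f i)\<^sup>2) + ip f f * ((\<integral>x. K x x \<partial>M) - (\<Sum>i\<in>F. \<mu> i))"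
proof -
  let ?r = "\<lambda>x. f x - (\<Sum>i\<in>F. coeff f i * eigenvector i x)"
  have r: "?r \<in> H" using F eigenvector_mem by (intro diff_mem f sum_mem scale_mem) auto
  have \<phi>: "integrable M (\<lambda>x. \<mu> i * (\<phi> i x)\<^sup>2)" if "i \<in> F" for i
    using eigenfunction_square_integrable that F by (auto simp: square_integrable_def)
  have "(\<integral>x. (?r x)\<^sup>2 \<partial>M) \<le> (\<integral>x. ip f f * (K x x - (\<Sum>i\<in>F. \<mu> i * (\<phi> i x)\<^sup>2)) \<partial>M)"
    using residual_square_le[OF F f] mem_square_integrable[OF r] \<phi> diagonal_integrable
    by (intro integral_mono) (auto simp: square_integrable_def space_M)
  also have "\<dots> = ip f f * ((\<integral>x. K x x \<partial>M) - (\<Sum>i\<in>F. \<integral>x. \<mu> i * (\<phi> i x)\<^sup>2 \<partial>M))"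
    using \<phi> diagonal_integrable by (simp add: Bochner_Integration.integral_sum)
  also have "(\<Sum>i\<in>F. \<integral>x. \<mu> i * (\<phi> i x)\<^sup>2 \<partial>M) = (\<Sum>i\<in>F. \<mu> i)"
    using F eigenfunctions_orthonormal by (intro sum.cong refl) (auto simp: power2_eq_square subset_iff)
  finally show ?thesis using integral_residual_square[OF F f] by simp
qed

text \<open>The error of the truncated expansion. Up to an arbitrarily small trace defect, the error is the
sum of the squared coefficients outside \<open>S\<close>; there each of them is at most \<open>\<tau>\<close> times the
corresponding term of Bessel's inequality in \<open>H\<close>.\<close>

theorem integral_residual_square_le:
  assumes S: "finite S" "S \<subseteq> I" and f: "f \<in> H"
    and \<tau>: "\<And>i. i \<in> I - S \<Longrightarrow> \<mu> i \<le> \<tau>" "0 \<le> \<tau>"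
  shows "(\<integral>x. (f x - (\<Sum>i\<in>S. coeff f i * eigenvector i x))\<^sup>2 \<partial>M) \<le> \<tau> * ip f f"
proof (rule field_le_epsilon)
  fix e :: real assume "0 < e"
  \<comment> \<open>the summand 1 keeps the denominator positive for \<open>f = 0\<close>\<close>
  define \<delta> where "\<delta> = e / (ip f f + 1)"
  have \<delta>: "0 < \<delta>" "ip f f * \<delta> \<le> e"
    using \<open>0 < e\<close> ip_nonneg[OF f] by (auto simp: \<delta>_def field_simps)
  from trace[OF \<delta>(1)] obtain F where F: "finite F" "F \<subseteq> I" "(\<integral>x. K x x \<partial>M) - \<delta> \<le> (\<Sum>i\<in>F. \<mu> i)"
    by blast
  let ?G = "S \<union> F"
  have G: "finite ?G" "?G \<subseteq> I" using S F by auto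
  have "(\<Sum>i\<in>F. \<mu> i) \<le> (\<Sum>i\<in>?G. \<mu> i)"
    using G eigenvalue_pos by (intro sum_mono2) (auto intro: less_imp_le)
  hence "(\<integral>x. K x x \<partial>M) - (\<Sum>i\<in>?G. \<mu> i) \<le> \<delta>" using F(3) by linarith
  hence "ip f f * ((\<integral>x. K x x \<partial>M) - (\<Sum>i\<in>?G. \<mu> i)) \<le> e"
    by (rule order_trans[OF mult_left_mono[OF _ ip_nonneg[OF f]] \<delta>(2)])
  hence "(\<integral>x. (f x)\<^sup>2 \<partial>M) \<le> (\<Sum>i\<in>?G. (coeff f i)\<^sup>2) + e"
    using integral_square_le_coeffs[OF G f] by linarith
  also have "(\<Sum>i\<in>?G. (coeff f i)\<^sup>2) = (\<Sum>i\<in>S. (coeff f i)\<^sup>2) + (\<Sum>i\<in>F - S. (coeff f i)\<^sup>2)"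
    using sum.union_disjoint[of S "F - S" "\<lambda>i. (coeff f i)\<^sup>2"] S F by auto
  also have "(\<Sum>i\<in>F - S. (coeff f i)\<^sup>2) \<le> (\<Sum>i\<in>F - S. \<tau> * ((coeff f i)\<^sup>2 / \<mu> i))"
  proof (intro sum_mono)
    fix i assume "i \<in> F - S"
    hence "0 < \<mu> i" "\<mu> i \<le> \<tau>" using F eigenvalue_pos \<tau> by auto
    hence "(coeff f i)\<^sup>2 * \<mu> i \<le> (coeff f i)\<^sup>2 * \<tau>" by (intro mult_left_mono) auto
    thus "(coeff f i)\<^sup>2 \<le> \<tau> * ((coeff f i)\<^sup>2 / \<mu> i)" using \<open>0 < \<mu> i\<close> by (simp add: field_simps)
  qed
  also have "\<dots> \<le> \<tau> * ip f f"
    unfolding sum_distrib_left[symmetric] using F f \<tau>(2) by (intro mult_left_mono bessel) auto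
  finally show "(\<integral>x. (f x - (\<Sum>i\<in>S. coeff f i * eigenvector i x))\<^sup>2 \<partial>M) \<le> \<tau> * ip f f + e"
    using integral_residual_square[OF S f] by linarith
qed

corollary integral_square_le:
  assumes "f \<in> H" "\<And>i. i \<in> I \<Longrightarrow> \<mu> i \<le> \<tau>" "0 \<le> \<tau>"
  shows "(\<integral>x. (f x)\<^sup>2 \<partial>M) \<le> \<tau> * ip f f"
  using integral_residual_square_le[of "{}" f \<tau>] assms by simp

text \<open>On the span of the eigenvectors with large eigenvalues the \<open>L\<^sub>2\<close>-norm is large compared with the
norm of \<open>H\<close>. This is the source of the lower bound for the error of all algorithms.\<close>

lemma integral_square_span_ge:
  fixes v :: "'i \<Rightarrow> real"
  assumes S: "finite S" "S \<subseteq> I" and \<tau>: "\<And>i. i \<in> S \<Longrightarrow> \<tau> \<le> \<mu> i"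
  defines "f \<equiv> (\<lambda>x. \<Sum>i\<in>S. v i * eigenvector i x)"
  shows "\<tau> * ip f f \<le> (\<integral>x. (f x)\<^sup>2 \<partial>M)" "ip f f = (\<Sum>i\<in>S. (v i)\<^sup>2 / \<mu> i)"
proof -
  have u: "eigenvector i \<in> H" if "i \<in> S" for i using that S eigenvector_mem by blast
  have f: "f \<in> H" unfolding f_def using u by (intro sum_mem scale_mem)
  have ip: "ip f f = (\<Sum>i\<in>S. v i * ip f (eigenvector i))"
  proof -
    have "ip f f = (\<Sum>i\<in>S. ip (\<lambda>t. v i * eigenvector i t) f)"
      using ip_sum[of S "\<lambda>i t. v i * eigenvector i t" f] u f
      by (simp only: f_def[symmetric] scale_mem)
    also have "\<dots> = (\<Sum>i\<in>S. v i * ip f (eigenvector i))"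
      using u f by (intro sum.cong refl) (metis ip_scale ip_commute)
    finally show ?thesis .
  qed
  have coeff: "coeff f i = v i" if i: "i \<in> S" for i
  proof -
    have "coeff f i = (\<integral>x. (\<Sum>j\<in>S. v j * (eigenvector j x * eigenvector i x)) \<partial>M)"
      unfolding coeff_eq_eigenvector f_def
      by (intro Bochner_Integration.integral_cong refl) (simp add: sum_distrib_right mult.assoc)
    also have "\<dots> = (\<Sum>j\<in>S. \<integral>x. v j * (eigenvector j x * eigenvector i x) \<partial>M)"
      using u i by (intro Bochner_Integration.integral_sum integrable_mult_right square_integrable_mult mem_square_integrable)
    also have "\<dots> = (\<Sum>j\<in>S. if j = i then v j else 0)"
      using S i by (intro sum.cong refl) (auto simp: integral_eigenvectors subset_iff)
    also have "\<dots> = v i" using S i by simp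
    finally show ?thesis .
  qed
  show ip_f: "ip f f = (\<Sum>i\<in>S. (v i)\<^sup>2 / \<mu> i)"
    unfolding ip using S f coeff by (intro sum.cong refl) (auto simp: ip_eigenvector power2_eq_square subset_iff)
  have "\<tau> * ip f f \<le> (\<Sum>i\<in>S. (v i)\<^sup>2)"
    unfolding ip_f sum_distrib_left
  proof (intro sum_mono)
    fix i assume i: "i \<in> S"
    hence "0 < \<mu> i" using S eigenvalue_pos by blast
    moreover have "(v i)\<^sup>2 * \<tau> \<le> (v i)\<^sup>2 * \<mu> i" using \<tau>[OF i] by (intro mult_left_mono) auto
    ultimately show "\<tau> * ((v i)\<^sup>2 / \<mu> i) \<le> (v i)\<^sup>2" by (simp add: field_simps)
  qed
  also have "\<dots> = (\<Sum>i\<in>S. (coeff f i)\<^sup>2)" using coeff by simp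
  also have "\<dots> = (\<integral>x. (f x)\<^sup>2 \<partial>M) - (\<integral>x. (f x - (\<Sum>i\<in>S. coeff f i * eigenvector i x))\<^sup>2 \<partial>M)"
    using integral_residual_square[OF S f] by simp
  also have "\<dots> \<le> (\<integral>x. (f x)\<^sup>2 \<partial>M)" by simp
  finally show "\<tau> * ip f f \<le> (\<integral>x. (f x)\<^sup>2 \<partial>M)" .
qed

end

section \<open>The information complexity as a number of eigenvalues\<close>

text \<open>With \<open>c k i\<close> the value of the \<open>k\<close>-th functional of an algorithm at the \<open>i\<close>-th eigenvector, \<open>v\<close>
consists of the coefficients of a function that the algorithm cannot distinguish from zero. The proof
is Gaussian elimination, by induction on the number of functionals.\<close>

lemma exists_common_zero:
  fixes c :: "nat \<Rightarrow> 'i \<Rightarrow> real"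
  assumes "finite S" "n < card S"
  shows "\<exists>v. (\<exists>i\<in>S. v i \<noteq> 0) \<and> (\<forall>k\<in>{1..n}. (\<Sum>i\<in>S. v i * c k i) = 0)"
  using assms
proof (induction n arbitrary: S c)
  case 0
  then obtain i where "i \<in> S" by fastforce
  thus ?case by (intro exI[of _ "\<lambda>_. 1"]) auto
next
  case (Suc n)
  show ?case
  proof (cases "\<forall>i\<in>S. c (Suc n) i = 0")
    case True
    from Suc.IH[of S c] Suc.prems obtain v where
      "\<exists>i\<in>S. v i \<noteq> 0" "\<forall>k\<in>{1..n}. (\<Sum>i\<in>S. v i * c k i) = 0" by auto
    with True show ?thesis by (intro exI[of _ v]) (auto simp: atLeastAtMostSuc_conv)
  next
    case False
    then obtain p where p: "p \<in> S" "c (Suc n) p \<noteq> 0" by blast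
    define S' where "S' = S - {p}"
    have S': "finite S'" "p \<notin> S'" "S = insert p S'" using Suc.prems p by (auto simp: S'_def)
    hence "n < card S'" using Suc.prems by simp
    \<comment> \<open>Gaussian elimination with pivot \<open>p\<close>\<close>
    define c' where "c' = (\<lambda>k i. c k i - c k p * c (Suc n) i / c (Suc n) p)"
    from Suc.IH[OF S'(1) \<open>n < card S'\<close>, of c'] obtain v where
      v: "\<exists>i\<in>S'. v i \<noteq> 0" "\<forall>k\<in>{1..n}. (\<Sum>i\<in>S'. v i * c' k i) = 0" by blast
    define b where "b = - (\<Sum>i\<in>S'. v i * c (Suc n) i) / c (Suc n) p"
    have sum: "(\<Sum>i\<in>S. (v(p := b)) i * c k i) = b * c k p + (\<Sum>i\<in>S'. v i * c k i)" for k
      unfolding S'(3) using S' by (subst sum.insert) (auto intro!: sum.cong)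
    have "(\<Sum>i\<in>S. (v(p := b)) i * c k i) = 0" if "k \<in> {1..Suc n}" for k
    proof (cases "k = Suc n")
      case True
      thus ?thesis unfolding sum using p by (simp add: b_def)
    next
      case False
      hence "0 = (\<Sum>i\<in>S'. v i * c' k i)" using v(2) that by simp
      also have "\<dots> = (\<Sum>i\<in>S'. v i * c k i) - c k p / c (Suc n) p * (\<Sum>i\<in>S'. v i * c (Suc n) i)"
        by (simp add: c'_def right_diff_distrib sum_subtractf sum_distrib_left mult_ac)
      also have "\<dots> = b * c k p + (\<Sum>i\<in>S'. v i * c k i)"
        by (simp add: b_def)
      finally show ?thesis unfolding sum by simp
    qed
    moreover have "\<exists>i\<in>S. (v(p := b)) i \<noteq> 0" using v(1) S' by auto
    ultimately show ?thesis by blast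
  qed
qed

lemma (in hilbert_function_space) dual_sum:
  assumes l: "l \<in> dual_space H ip" and u: "\<And>i. i \<in> S \<Longrightarrow> u i \<in> H"
  shows "l (\<lambda>t. \<Sum>i\<in>S. v i * u i t) = (\<Sum>i\<in>S. v i * l (u i))"
proof -
  have add: "l (\<lambda>t. f t + g t) = l f + l g" if "f \<in> H" "g \<in> H" for f g
    using l that by (simp add: dual_space_def)
  have scale: "l (\<lambda>t. c * f t) = c * l f" if "f \<in> H" for f c
    using l that by (simp add: dual_space_def)
  have zero: "l (\<lambda>t. 0) = 0" using scale[OF zero_mem, of 0] by simp
  show ?thesis using u
  proof (induction S rule: infinite_finite_induct)
    case (insert i S)
    have "(\<lambda>t. \<Sum>i\<in>S. v i * u i t) \<in> H" using insert.prems by (intro sum_mem scale_mem) auto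
    with insert show ?case
      using add[of "\<lambda>t. v i * u i t" "\<lambda>t. \<Sum>i\<in>S. v i * u i t"] by (simp add: scale scale_mem)
  qed (simp_all add: zero)
qed

text \<open>The projection onto the eigenvectors in \<open>S\<close> attains the error demand. With fewer functionals there
is a unit vector in the span of \<open>S\<close> on which all of them vanish, hence the algorithm returns zero there
and the error is at least the square root of the smallest eigenvalue in \<open>S\<close>. The initial error is
attained at the eigenvector \<open>i0\<close> of the largest eigenvalue.\<close>

theorem info_complexity_eq_card:
  assumes "kernel_eigensystem (Rd d) K H ip (gaussian_measure d) I \<phi> \<mu>"
    and S: "finite S" "S \<subseteq> I" "i0 \<in> S" and \<epsilon>: "0 < \<epsilon>"
    and largest: "\<And>i. i \<in> I \<Longrightarrow> \<mu> i \<le> \<mu> i0"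
    and above: "\<And>i. i \<in> S \<Longrightarrow> \<epsilon>\<^sup>2 * \<mu> i0 < \<mu> i"
    and below: "\<And>i. i \<in> I - S \<Longrightarrow> \<mu> i \<le> \<epsilon>\<^sup>2 * \<mu> i0"
  shows "info_complexity H ip d \<epsilon> = card S"
proof -
  interpret kernel_eigensystem "Rd d" K H ip "gaussian_measure d" I \<phi> \<mu> by fact
  define B where "B = {f \<in> H. ip_norm ip f \<le> 1}"
  have B: "f \<in> B \<longleftrightarrow> f \<in> H \<and> ip f f \<le> 1" for f
    by (auto simp: B_def ip_norm_def)
  have zero: "(\<lambda>t. 0) \<in> B" using zero_mem ip_zero by (simp add: B)
  have i0I: "i0 \<in> I" "0 < \<mu> i0" using S eigenvalue_pos by auto
  have eps_sqrt: "sqrt (\<epsilon>\<^sup>2 * \<mu> i0) = \<epsilon> * sqrt (\<mu> i0)"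
    using \<epsilon> by (simp add: real_sqrt_mult)
  have L2_nonneg: "0 \<le> L2_norm d f" for f by (simp add: L2_norm_def)
  have L2_le: "L2_norm d f \<le> sqrt (\<mu> i0)" if "f \<in> B" for f
  proof -
    have "(LINT x|gaussian_measure d. (f x)\<^sup>2) \<le> \<mu> i0 * ip f f"
      using that i0I largest by (intro integral_square_le) (auto simp: B)
    also have "\<dots> \<le> \<mu> i0 * 1" using that i0I by (intro mult_left_mono) (auto simp: B)
    finally show ?thesis by (simp add: L2_norm_def)
  qed
  have initial: "initial_error H ip d = sqrt (\<mu> i0)"
  proof -
    define f where "f = (\<lambda>x. sqrt (\<mu> i0) * eigenvector i0 x)"
    have "ip f f = 1"
      unfolding f_def using eigenvector_mem[OF i0I(1)] i0I scale_mem[OF eigenvector_mem[OF i0I(1)]]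
      by (simp add: ip_scale ip_scale_right ip_eigenvectors)
    hence "f \<in> B" using eigenvector_mem[OF i0I(1)] by (simp add: B f_def scale_mem)
    have "(LINT x|gaussian_measure d. (f x)\<^sup>2) = \<mu> i0"
      using integral_eigenvectors[OF i0I(1) i0I(1)] i0I
      by (simp add: f_def power_mult_distrib) (simp add: power2_eq_square)
    hence "L2_norm d f = sqrt (\<mu> i0)" by (simp add: L2_norm_def)
    thus ?thesis
      unfolding initial_error_def B_def[symmetric]
      using \<open>f \<in> B\<close> L2_le by (intro cSup_eq_maximum) (auto intro!: image_eqI[of _ _ f])
  qed
  \<comment> \<open>the worst case error is a supremum in the reals, which dominates the individual errors only if these are bounded\<close>
  have bdd: "bdd_above ((\<lambda>f. L2_norm d (\<lambda>x. f x - A f x)) ` B)"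
    if A: "A \<in> linear_algorithms H ip d n" for A n
  proof -
    from A obtain a l where A_eq: "A = (\<lambda>f x. \<Sum>k=1..n. a k x * l k f)"
      and al: "\<And>k. k \<in> {1..n} \<Longrightarrow> a k \<in> L2_space d \<and> l k \<in> dual_space H ip"
      by (auto simp: linear_algorithms_def)
    have "\<exists>C. \<forall>f\<in>H. \<bar>l k f\<bar> \<le> C * ip_norm ip f" if "k \<in> {1..n}" for k
      using al[OF that] by (simp add: dual_space_def)
    then obtain C where C: "\<And>k f. k \<in> {1..n} \<Longrightarrow> f \<in> H \<Longrightarrow> \<bar>l k f\<bar> \<le> C k * ip_norm ip f"
      by metis
    have a_int: "integrable (gaussian_measure d) (\<lambda>x. (a k x)\<^sup>2)" if "k \<in> {1..n}" for k
      using al[OF that] by (simp add: L2_space_def)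
    let ?R = "2 * \<mu> i0 + 2 * ((\<Sum>k=1..n. LINT x|gaussian_measure d. (a k x)\<^sup>2) * (\<Sum>k=1..n. (C k)\<^sup>2))"
    have "L2_norm d (\<lambda>x. f x - A f x) \<le> sqrt ?R" if f: "f \<in> B" for f
    proof -
      have fH: "f \<in> H" "ip f f \<le> 1" "ip_norm ip f \<le> 1" using f by (auto simp: B ip_norm_def)
      have l2: "(l k f)\<^sup>2 \<le> (C k)\<^sup>2" if "k \<in> {1..n}" for k
      proof -
        have "\<bar>l k f\<bar> \<le> \<bar>C k\<bar> * ip_norm ip f"
          using C[OF that fH(1)] ip_norm_nonneg[OF fH(1)] by (meson abs_ge_self mult_right_mono order_trans)
        also have "\<dots> \<le> \<bar>C k\<bar>" using fH by (simp add: mult_left_le)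
        finally show ?thesis by (simp add: abs_le_square_iff)
      qed
      have pointwise: "(f x - A f x)\<^sup>2 \<le> 2 * (f x)\<^sup>2 + 2 * ((\<Sum>k=1..n. (a k x)\<^sup>2) * (\<Sum>k=1..n. (C k)\<^sup>2))" for x
      proof -
        have "(A f x)\<^sup>2 \<le> (\<Sum>k=1..n. (a k x)\<^sup>2) * (\<Sum>k=1..n. (l k f)\<^sup>2)"
          unfolding A_eq by (rule Cauchy_Schwarz_ineq_sum)
        also have "\<dots> \<le> (\<Sum>k=1..n. (a k x)\<^sup>2) * (\<Sum>k=1..n. (C k)\<^sup>2)"
          using l2 by (intro mult_left_mono sum_mono sum_nonneg) auto
        finally have "(A f x)\<^sup>2 \<le> (\<Sum>k=1..n. (a k x)\<^sup>2) * (\<Sum>k=1..n. (C k)\<^sup>2)" .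
        moreover have "(f x - A f x)\<^sup>2 \<le> 2 * (f x)\<^sup>2 + 2 * (A f x)\<^sup>2"
          using zero_le_power2[of "f x + A f x"] by (simp add: power2_sum power2_diff)
        ultimately show ?thesis by linarith
      qed
      have f_int: "integrable (gaussian_measure d) (\<lambda>x. (f x)\<^sup>2)"
        using mem_square_integrable[OF fH(1)] by (simp add: square_integrable_def)
      have a_sum: "integrable (gaussian_measure d) (\<lambda>x. \<Sum>k=1..n. (a k x)\<^sup>2)"
        "(LINT x|gaussian_measure d. (\<Sum>k=1..n. (a k x)\<^sup>2)) = (\<Sum>k=1..n. LINT x|gaussian_measure d. (a k x)\<^sup>2)"
        using a_int by (auto intro!: Bochner_Integration.integrable_sum Bochner_Integration.integral_sum)
      have "(LINT x|gaussian_measure d. (f x - A f x)\<^sup>2) \<le>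
            (LINT x|gaussian_measure d. 2 * (f x)\<^sup>2 + 2 * ((\<Sum>k=1..n. (a k x)\<^sup>2) * (\<Sum>k=1..n. (C k)\<^sup>2)))"
        using pointwise f_int a_sum(1)
        by (intro integral_mono' Bochner_Integration.integrable_add integrable_mult_right integrable_mult_left)
          (auto intro!: add_nonneg_nonneg mult_nonneg_nonneg sum_nonneg)
      also have "\<dots> = 2 * (LINT x|gaussian_measure d. (f x)\<^sup>2)
          + 2 * ((\<Sum>k=1..n. LINT x|gaussian_measure d. (a k x)\<^sup>2) * (\<Sum>k=1..n. (C k)\<^sup>2))"
        unfolding a_sum(2)[symmetric] using f_int a_sum(1) by simp
      also have "(LINT x|gaussian_measure d. (f x)\<^sup>2) \<le> \<mu> i0"
        using L2_le[OF f] by (simp add: L2_norm_def)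
      finally show ?thesis by (simp add: L2_norm_def)
    qed
    thus ?thesis by (auto intro!: bdd_aboveI)
  qed
  have error_ge: "L2_norm d (\<lambda>x. f x - A f x) \<le> worst_case_error H ip d A"
    if "A \<in> linear_algorithms H ip d n" "f \<in> B" for A n f
    unfolding worst_case_error_def B_def[symmetric] by (rule cSUP_upper[OF that(2) bdd[OF that(1)]])
  have attained: "minimal_error H ip d (card S) \<le> \<epsilon> * initial_error H ip d"
  proof -
    obtain g where g: "bij_betw g {1..card S} S"
      using S(1) by (blast dest: ex_bij_betw_nat_finite_1)
    define A where "A = (\<lambda>f x. \<Sum>k=1..card S. eigenvector (g k) x * coeff f (g k))"
    have A: "A \<in> linear_algorithms H ip d (card S)"
    proof -
      have "eigenvector (g k) \<in> L2_space d \<and> (\<lambda>f. coeff f (g k)) \<in> dual_space H ip"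
        if "k \<in> {1..card S}" for k
      proof -
        have "g k \<in> I" using g that S by (auto simp: bij_betw_def)
        thus ?thesis
          using mem_square_integrable[OF eigenvector_mem] coeff_dual
          by (auto simp: L2_space_def square_integrable_def)
      qed
      thus ?thesis
        unfolding linear_algorithms_def A_def mem_Collect_eq
        by (intro exI[of _ "\<lambda>k. eigenvector (g k)"] exI[of _ "\<lambda>k f. coeff f (g k)"] conjI refl) blast
    qed
    have A_eq: "A f x = (\<Sum>i\<in>S. coeff f i * eigenvector i x)" for f x
      unfolding A_def using sum.reindex_bij_betw[OF g, of "\<lambda>i. coeff f i * eigenvector i x"]
      by (simp add: mult.commute)
    have "worst_case_error H ip d A \<le> sqrt (\<epsilon>\<^sup>2 * \<mu> i0)"
      unfolding worst_case_error_def B_def[symmetric]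
    proof (rule cSUP_least)
      fix f assume "f \<in> B"
      hence f: "f \<in> H" "ip f f \<le> 1" by (auto simp: B)
      have "(LINT x|gaussian_measure d. (f x - A f x)\<^sup>2) \<le> (\<epsilon>\<^sup>2 * \<mu> i0) * ip f f"
        unfolding A_eq using i0I by (intro integral_residual_square_le S f below) auto
      also have "\<dots> \<le> \<epsilon>\<^sup>2 * \<mu> i0" using f i0I by (intro mult_left_le) auto
      finally show "L2_norm d (\<lambda>x. f x - A f x) \<le> sqrt (\<epsilon>\<^sup>2 * \<mu> i0)" by (simp add: L2_norm_def)
    qed (use zero in auto)
    moreover have "minimal_error H ip d (card S) \<le> worst_case_error H ip d A"
      unfolding minimal_error_def
    proof (rule cINF_lower[OF _ A])
      show "bdd_below (worst_case_error H ip d ` linear_algorithms H ip d (card S))"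
        using error_ge[OF _ zero] L2_nonneg by (auto intro!: bdd_belowI2[where m = 0] intro: order_trans)
    qed
    ultimately show ?thesis unfolding initial eps_sqrt by linarith
  qed
  have not_attained: "\<epsilon> * initial_error H ip d < minimal_error H ip d n" if n: "n < card S" for n
  proof -
    define \<tau> where "\<tau> = Min (\<mu> ` S)"
    have \<tau>: "\<tau> \<le> \<mu> i" if "i \<in> S" for i unfolding \<tau>_def using S that by auto
    have "\<tau> \<in> \<mu> ` S" unfolding \<tau>_def using S by (intro Min_in) auto
    hence \<tau>_gt: "\<epsilon>\<^sup>2 * \<mu> i0 < \<tau>" using above by auto
    have "sqrt \<tau> \<le> worst_case_error H ip d A" if A: "A \<in> linear_algorithms H ip d n" for A
    proof -
      from A obtain a l where A_eq: "A = (\<lambda>f x. \<Sum>k=1..n. a k x * l k f)"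
        and l: "\<And>k. k \<in> {1..n} \<Longrightarrow> l k \<in> dual_space H ip"
        by (auto simp: linear_algorithms_def)
      from exists_common_zero[OF S(1) n, of "\<lambda>k i. l k (eigenvector i)"]
      obtain v where v: "\<exists>i\<in>S. v i \<noteq> 0"
        and v0: "\<forall>k\<in>{1..n}. (\<Sum>i\<in>S. v i * l k (eigenvector i)) = 0"
        by blast
      define s where "s = sqrt (\<Sum>i\<in>S. (v i)\<^sup>2 / \<mu> i)"
      have pos: "0 < (\<Sum>i\<in>S. (v i)\<^sup>2 / \<mu> i)"
      proof -
        from v obtain i where i: "i \<in> S" "v i \<noteq> 0" by blast
        have \<mu>: "0 < \<mu> i" if "i \<in> S" for i using that S eigenvalue_pos by blast
        show ?thesis
          using S i \<mu> by (intro sum_pos2[of S i]) (auto simp: less_imp_le)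
      qed
      hence s: "0 < s" "s\<^sup>2 = (\<Sum>i\<in>S. (v i)\<^sup>2 / \<mu> i)" by (auto simp: s_def)
      define f where "f = (\<lambda>x. \<Sum>i\<in>S. v i / s * eigenvector i x)"
      have u: "eigenvector i \<in> H" if "i \<in> S" for i using that S eigenvector_mem by blast
      have f: "f \<in> H" unfolding f_def using u by (intro sum_mem scale_mem)
      have ip: "ip f f = 1"
      proof -
        have "ip f f = (\<Sum>i\<in>S. (v i / s)\<^sup>2 / \<mu> i)"
          unfolding f_def by (rule integral_square_span_ge(2)[OF S(1,2) \<tau>])
        also have "\<dots> = (\<Sum>i\<in>S. (v i)\<^sup>2 / \<mu> i) / s\<^sup>2"
          by (simp add: sum_divide_distrib power_divide divide_divide_eq_left mult.commute)
        finally show ?thesis using s pos by simp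
      qed
      have "l k f = 0" if "k \<in> {1..n}" for k
      proof -
        have "l k f = (\<Sum>i\<in>S. v i / s * l k (eigenvector i))"
          unfolding f_def using u by (rule dual_sum[OF l[OF that]])
        also have "\<dots> = (\<Sum>i\<in>S. v i * l k (eigenvector i)) / s" by (simp add: sum_divide_distrib)
        finally show ?thesis using v0 that by simp
      qed
      hence "A f x = 0" for x unfolding A_eq by simp
      hence "L2_norm d f \<le> worst_case_error H ip d A"
        using error_ge[OF A, of f] f ip by (simp add: B)
      moreover have "sqrt \<tau> \<le> L2_norm d f"
        using integral_square_span_ge(1)[OF S(1,2) \<tau>, where v = "\<lambda>i. v i / s"] ip
        unfolding L2_norm_def f_def by simp
      ultimately show ?thesis by linarith
    qed
    moreover have "linear_algorithms H ip d n \<noteq> {}"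
    proof -
      have "(\<lambda>x. 0) \<in> L2_space d" "(\<lambda>f. 0) \<in> dual_space H ip"
        by (auto simp: L2_space_def dual_space_def intro!: exI[of _ 0])
      hence "(\<lambda>f x. \<Sum>k=1..n. 0 * 0) \<in> linear_algorithms H ip d n"
        unfolding linear_algorithms_def mem_Collect_eq
        by (intro exI[of _ "\<lambda>k x. 0"] exI[of _ "\<lambda>k f. 0"] conjI refl) blast
      thus ?thesis by blast
    qed
    ultimately have "sqrt \<tau> \<le> minimal_error H ip d n"
      unfolding minimal_error_def by (intro cINF_greatest)
    thus ?thesis unfolding initial eps_sqrt[symmetric] using \<tau>_gt real_sqrt_less_mono[OF \<tau>_gt] by linarith
  qed
  show ?thesis
    unfolding info_complexity_def
  proof (rule Least_equality)
    have "1 \<le> card S" using S by (simp add: Suc_le_eq card_gt_0_iff) blast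
    thus "1 \<le> card S \<and> minimal_error H ip d (card S) \<le> \<epsilon> * initial_error H ip d"
      using attained by blast
  next
    fix n assume "1 \<le> n \<and> minimal_error H ip d n \<le> \<epsilon> * initial_error H ip d"
    thus "card S \<le> n" using not_attained[of n] by force
  qed
qed

section \<open>The eigenfunctions of the univariate Gaussian kernel\<close>

text \<open>The mean of \<open>y ^ k\<close> under a normal distribution is a polynomial in its mean \<open>\<mu>\<close>, since translation
reduces it to the centred moments.\<close>

lemma integrable_normal_density_power:
  assumes "0 < \<sigma>"
  shows "integrable lborel (\<lambda>y. normal_density \<mu> \<sigma> y * y ^ k)"
    and "(\<integral>y. normal_density \<mu> \<sigma> y * y ^ k \<partial>lborel) =
           (\<Sum>j\<le>k. of_nat (k choose j) * \<mu> ^ j * (\<integral>u. normal_density 0 \<sigma> u * u ^ (k - j) \<partial>lborel))"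
proof -
  have int0: "integrable lborel (\<lambda>u. normal_density 0 \<sigma> u * u ^ j)" for j
    using integrable_normal_moment[OF assms, of 0 j] by simp
  have eq: "normal_density \<mu> \<sigma> (\<mu> + 1 * u) * (\<mu> + 1 * u) ^ k =
              (\<Sum>j\<le>k. of_nat (k choose j) * \<mu> ^ j * (normal_density 0 \<sigma> u * u ^ (k - j)))" for u
  proof -
    have "normal_density \<mu> \<sigma> (\<mu> + 1 * u) = normal_density 0 \<sigma> u" by (simp add: normal_density_def)
    thus ?thesis by (simp add: binomial_ring sum_distrib_left mult_ac)
  qed
  show "integrable lborel (\<lambda>y. normal_density \<mu> \<sigma> y * y ^ k)"
  proof (subst lborel_integrable_real_affine_iff[symmetric, of 1 _ \<mu>])
    show "integrable lborel (\<lambda>u. normal_density \<mu> \<sigma> (\<mu> + 1 * u) * (\<mu> + 1 * u) ^ k)"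
      unfolding eq by (intro Bochner_Integration.integrable_sum integrable_mult_right int0)
  qed simp
  have "(\<integral>y. normal_density \<mu> \<sigma> y * y ^ k \<partial>lborel) =
        (\<integral>u. normal_density \<mu> \<sigma> (\<mu> + 1 * u) * (\<mu> + 1 * u) ^ k \<partial>lborel)"
    by (subst lborel_integral_real_affine[of 1 _ \<mu>]) simp_all
  also have "\<dots> = (\<Sum>j\<le>k. of_nat (k choose j) * \<mu> ^ j * (\<integral>u. normal_density 0 \<sigma> u * u ^ (k - j) \<partial>lborel))"
    unfolding eq by (subst Bochner_Integration.integral_sum) (auto intro!: integrable_mult_right int0)
  finally show "(\<integral>y. normal_density \<mu> \<sigma> y * y ^ k \<partial>lborel) =
           (\<Sum>j\<le>k. of_nat (k choose j) * \<mu> ^ j * (\<integral>u. normal_density 0 \<sigma> u * u ^ (k - j) \<partial>lborel))" .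
qed

lemma integrable_normal_density_poly:
  fixes p :: "real poly"
  assumes "0 < \<sigma>"
  shows "integrable lborel (\<lambda>y. normal_density \<mu> \<sigma> y * poly p y)"
proof -
  have "integrable lborel (\<lambda>y. \<Sum>i\<le>degree p. coeff p i * (normal_density \<mu> \<sigma> y * y ^ i))"
    using integrable_normal_density_power(1)[OF assms] by (intro Bochner_Integration.integrable_sum integrable_mult_right)
  thus ?thesis by (simp add: poly_altdef sum_distrib_left mult_ac)
qed

lemma integrable_gaussian_poly:
  fixes p :: "real poly"
  assumes "0 < a"
  shows "integrable lborel (\<lambda>y. poly p y * exp (- (a * y\<^sup>2)))"
proof -
  define \<sigma> where "\<sigma> = 1 / sqrt (2 * a)"
  have \<sigma>: "0 < \<sigma>" "\<sigma>\<^sup>2 = 1 / (2 * a)" using assms by (auto simp: \<sigma>_def power_divide)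
  have eq: "sqrt (2 * pi * \<sigma>\<^sup>2) * (normal_density 0 \<sigma> y * poly p y) = poly p y * exp (- (a * y\<^sup>2))" for y
    using assms by (simp add: normal_density_def \<sigma>(2))
  thus ?thesis
    using integrable_mult_right[OF integrable_normal_density_poly[OF \<sigma>(1), of 0 p], of "sqrt (2 * pi * \<sigma>\<^sup>2)"]
    unfolding eq by blast
qed

text \<open>The operator that averages a polynomial over the normal distribution with mean \<open>\<omega> * x\<close>, as a
relation between polynomials. What matters about the image is its leading coefficient.\<close>

definition averages_to :: "real \<Rightarrow> real \<Rightarrow> real poly \<Rightarrow> real poly \<Rightarrow> bool" where
  "averages_to \<omega> \<sigma> p q \<longleftrightarrow> (\<forall>x. (\<integral>y. normal_density (\<omega> * x) \<sigma> y * poly p y \<partial>lborel) = poly q x)"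

lemma averages_to_add:
  assumes "0 < \<sigma>" "averages_to \<omega> \<sigma> p q" "averages_to \<omega> \<sigma> p' q'"
  shows "averages_to \<omega> \<sigma> (p + p') (q + q')"
  using assms integrable_normal_density_poly[OF assms(1)] by (simp add: averages_to_def distrib_left)

lemma averages_to_smult:
  assumes "averages_to \<omega> \<sigma> p q"
  shows "averages_to \<omega> \<sigma> (smult c p) (smult c q)"
  using assms by (simp add: averages_to_def mult.left_commute)

lemma averages_to_monom:
  assumes "0 < \<sigma>"
  obtains q where "averages_to \<omega> \<sigma> (monom 1 n) q" "coeff q n = \<omega> ^ n" "\<And>i. n < i \<Longrightarrow> coeff q i = 0"
proof
  define m where "m = (\<lambda>j. \<integral>u. normal_density 0 \<sigma> u * u ^ j \<partial>lborel)"
  define q where "q = (\<Sum>j\<le>n. monom (of_nat (n choose j) * \<omega> ^ j * m (n - j)) j)"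
  show "averages_to \<omega> \<sigma> (monom 1 n) q"
    unfolding averages_to_def
  proof
    fix x
    have "(\<integral>y. normal_density (\<omega> * x) \<sigma> y * poly (monom 1 n) y \<partial>lborel) =
        (\<Sum>j\<le>n. of_nat (n choose j) * (\<omega> * x) ^ j * m (n - j))"
      unfolding poly_monom mult_1 m_def by (rule integrable_normal_density_power(2)[OF assms])
    also have "\<dots> = poly q x"
      by (simp add: q_def poly_sum poly_monom power_mult_distrib mult_ac)
    finally show "(\<integral>y. normal_density (\<omega> * x) \<sigma> y * poly (monom 1 n) y \<partial>lborel) = poly q x" .
  qed
  have coeff: "coeff q i = (\<Sum>j\<le>n. if j = i then of_nat (n choose j) * \<omega> ^ j * m (n - j) else 0)" for i
    by (simp add: q_def coeff_sum)
  have "m 0 = 1" using assms by (simp add: m_def)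
  thus "coeff q n = \<omega> ^ n" by (simp add: coeff)
  show "coeff q i = 0" if "n < i" for i
    unfolding coeff using that by simp
qed

text \<open>Write \<open>T\<close> for the averaging operator. It is triangular with diagonal entries \<open>\<omega> ^ n\<close>, hence
\<open>T - \<omega> ^ k\<close> is invertible on the polynomials of degree less than \<open>k\<close>. The equation
\<open>T q - \<omega> ^ k * q = r\<close> is solved from the leading coefficient downwards.\<close>

lemma averages_to_shifted_solution:
  fixes \<omega> :: real
  assumes "0 < \<sigma>" "0 < \<omega>" "\<omega> < 1" "n \<le> k" "\<And>i. n \<le> i \<Longrightarrow> coeff r i = 0"
  shows "\<exists>q. (\<forall>i\<ge>n. coeff q i = 0) \<and> averages_to \<omega> \<sigma> q (smult (\<omega> ^ k) q + r)"
  using assms(4,5)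
proof (induction n arbitrary: r)
  case 0
  hence "r = 0" by (intro poly_eqI) simp
  thus ?case by (intro exI[of _ 0]) (simp add: averages_to_def)
next
  case (Suc n)
  obtain Q where Q: "averages_to \<omega> \<sigma> (monom 1 n) Q" "coeff Q n = \<omega> ^ n" "\<And>i. n < i \<Longrightarrow> coeff Q i = 0"
    using averages_to_monom[OF assms(1)] by blast
  have "\<omega> ^ k < \<omega> ^ n" using Suc.prems assms(2,3) by (intro power_strict_decreasing) auto
  hence gap: "\<omega> ^ n - \<omega> ^ k \<noteq> 0" by simp
  \<comment> \<open>the multiple of \<open>x ^ n\<close> that removes the leading coefficient of \<open>r\<close>\<close>
  define b where "b = coeff r n / (\<omega> ^ n - \<omega> ^ k)"
  define r' where "r' = r - smult b (Q - smult (\<omega> ^ k) (monom 1 n))"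
  have "coeff r' i = 0" if "n \<le> i" for i
  proof (cases "i = n")
    case True
    thus ?thesis using gap by (simp add: r'_def b_def Q(2))
  next
    case False
    thus ?thesis using that Suc.prems(2) Q(3) by (simp add: r'_def)
  qed
  with Suc.IH[of r'] Suc.prems obtain q where
    q: "\<forall>i\<ge>n. coeff q i = 0" "averages_to \<omega> \<sigma> q (smult (\<omega> ^ k) q + r')" by auto
  have "smult (\<omega> ^ k) q + r' + smult b Q = smult (\<omega> ^ k) (q + smult b (monom 1 n)) + r"
    by (simp add: r'_def smult_add_right smult_diff_right mult.commute)
  hence "averages_to \<omega> \<sigma> (q + smult b (monom 1 n)) (smult (\<omega> ^ k) (q + smult b (monom 1 n)) + r)"
    using averages_to_add[OF assms(1) q(2) averages_to_smult[OF Q(1), of b]] by simp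
  moreover have "\<forall>i\<ge>Suc n. coeff (q + smult b (monom 1 n)) i = 0"
    using q(1) by simp
  ultimately show ?case by blast
qed

text \<open>The monomial of degree \<open>k\<close> is an eigenvector modulo polynomials of smaller degree, and the
error is removed by the preceding lemma. The result is a rescaled Hermite polynomial.\<close>

lemma averages_to_eigenpolynomial:
  assumes "0 < \<sigma>" "0 < \<omega>" "\<omega> < 1"
  shows "\<exists>p. p \<noteq> 0 \<and> averages_to \<omega> \<sigma> p (smult (\<omega> ^ k) p)"
proof -
  obtain Q where Q: "averages_to \<omega> \<sigma> (monom 1 k) Q" "coeff Q k = \<omega> ^ k" "\<And>i. k < i \<Longrightarrow> coeff Q i = 0"
    using averages_to_monom[OF assms(1)] by blast
  define r where "r = smult (\<omega> ^ k) (monom 1 k) - Q"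
  have "coeff r i = 0" if "k \<le> i" for i
    using that Q(2,3) by (cases "i = k") (simp_all add: r_def)
  from averages_to_shifted_solution[OF assms order_refl this] obtain q where
    q: "\<forall>i\<ge>k. coeff q i = 0" "averages_to \<omega> \<sigma> q (smult (\<omega> ^ k) q + r)" by auto
  have "averages_to \<omega> \<sigma> (q + monom 1 k) (smult (\<omega> ^ k) (q + monom 1 k))"
    using averages_to_add[OF assms(1) q(2) Q(1)] by (simp add: r_def smult_add_right)
  moreover have "coeff (q + monom 1 k) k = 1" using q(1) by simp
  hence "q + monom 1 k \<noteq> 0" by (metis coeff_0 zero_neq_one)
  ultimately show ?thesis by blast
qed

text \<open>The squared shape parameter is written as \<open>\<delta> * (1 + \<delta>)\<close> because exactly then the quadratic form in
the exponent is \<open>\<delta> * x\<^sup>2\<close> plus the square of \<open>(1 + \<delta>) * y - \<delta> * x\<close>, so that the factor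
\<open>exp (- (\<delta> * y\<^sup>2))\<close> is reproduced by the kernel.\<close>

lemma gaussian_kernel_completing_square:
  fixes x y \<delta> :: real
  assumes "0 < \<delta>"
  shows "exp (- (\<delta> * (1 + \<delta>) * (x - y)\<^sup>2)) * exp (- (\<delta> * y\<^sup>2)) * (exp (- y\<^sup>2) / sqrt pi) =
           (1 - \<delta> / (1 + \<delta>)) * exp (- (\<delta> * x\<^sup>2)) *
             normal_density (\<delta> / (1 + \<delta>) * x) (1 / (sqrt 2 * (1 + \<delta>))) y"
proof -
  let ?\<sigma> = "1 / (sqrt 2 * (1 + \<delta>))"
  have \<sigma>: "?\<sigma>\<^sup>2 = 1 / (2 * (1 + \<delta>)\<^sup>2)" by (simp add: power_divide power_mult_distrib)
  have "2 * pi * ?\<sigma>\<^sup>2 = pi / (1 + \<delta>)\<^sup>2" unfolding \<sigma> by simp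
  hence "sqrt (2 * pi * ?\<sigma>\<^sup>2) = sqrt pi / (1 + \<delta>)"
    using assms by (simp add: real_sqrt_divide)
  moreover have "- (y - \<delta> / (1 + \<delta>) * x)\<^sup>2 / (2 * ?\<sigma>\<^sup>2) = - ((1 + \<delta>) * y - \<delta> * x)\<^sup>2"
  proof -
    have "(1 + \<delta>) * y - \<delta> * x = (1 + \<delta>) * (y - \<delta> / (1 + \<delta>) * x)"
      using assms by (simp add: right_diff_distrib)
    thus ?thesis unfolding \<sigma> by (simp add: power_mult_distrib)
  qed
  ultimately have nd: "normal_density (\<delta> / (1 + \<delta>) * x) ?\<sigma> y =
      (1 + \<delta>) / sqrt pi * exp (- ((1 + \<delta>) * y - \<delta> * x)\<^sup>2)"
    by (simp add: normal_density_def)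
  have "1 - \<delta> / (1 + \<delta>) = 1 / (1 + \<delta>)" using assms by (simp add: field_simps)
  hence "(1 - \<delta> / (1 + \<delta>)) * exp (- (\<delta> * x\<^sup>2)) * normal_density (\<delta> / (1 + \<delta>) * x) ?\<sigma> y =
      exp (- (\<delta> * x\<^sup>2)) * exp (- ((1 + \<delta>) * y - \<delta> * x)\<^sup>2) / sqrt pi"
    unfolding nd using assms by (simp only: ) simp
  also have "exp (- (\<delta> * x\<^sup>2)) * exp (- ((1 + \<delta>) * y - \<delta> * x)\<^sup>2) =
      exp (- (\<delta> * (1 + \<delta>) * (x - y)\<^sup>2)) * exp (- (\<delta> * y\<^sup>2)) * exp (- y\<^sup>2)"
    unfolding exp_add[symmetric] by (rule arg_cong[of _ _ exp]) (simp add: power2_eq_square algebra_simps)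
  finally show ?thesis by simp
qed

lemma AE_poly_nonzero:
  fixes p :: "real poly"
  assumes "p \<noteq> 0"
  shows "AE y in lborel. poly p y \<noteq> 0"
proof (rule AE_I')
  show "{y. poly p y = 0} \<in> null_sets lborel"
    using poly_roots_finite[OF assms] by (intro finite_imp_null_set_lborel)
qed auto

text \<open>The univariate kernel, parametrised by the rate \<open>\<delta>\<close> of the Gaussian factor in its eigenfunctions
instead of by its shape parameter.\<close>

locale gaussian_kernel_1 =
  fixes \<delta> :: real
  assumes \<delta>_pos: "0 < \<delta>"
begin

definition w :: "real \<Rightarrow> real" where
  "w y = exp (- y\<^sup>2) / sqrt pi"

definition \<kappa> :: "real \<Rightarrow> real \<Rightarrow> real" where
  "\<kappa> x y = exp (- (\<delta> * (1 + \<delta>) * (x - y)\<^sup>2))"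

definition \<omega> :: real where
  "\<omega> = \<delta> / (1 + \<delta>)"

lemma \<omega>: "0 < \<omega>" "\<omega> < 1"
  using \<delta>_pos by (auto simp: \<omega>_def)

lemma \<kappa>_commute: "\<kappa> x y = \<kappa> y x"
  by (simp add: \<kappa>_def power2_commute)

lemma \<kappa>_bounds: "0 < \<kappa> x y" "\<kappa> x y \<le> 1"
  using \<delta>_pos by (auto simp: \<kappa>_def)

lemma w_nonneg: "0 \<le> w y"
  by (simp add: w_def)

lemma measurable_w_\<kappa> [measurable]:
  "w \<in> borel_measurable borel" "(\<lambda>(x, y). \<kappa> x y) \<in> borel_measurable (borel \<Otimes>\<^sub>M borel)"
  unfolding w_def[abs_def] \<kappa>_def[abs_def] by measurable

definition \<psi> :: "real poly \<Rightarrow> real \<Rightarrow> real" where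
  "\<psi> p y = poly p y * exp (- (\<delta> * y\<^sup>2))"

lemma measurable_\<psi> [measurable]: "\<psi> p \<in> borel_measurable borel"
  unfolding \<psi>_def[abs_def] by (intro borel_measurable_continuous_onI continuous_intros)

lemma integrable_\<psi>: "integrable lborel (\<lambda>y. \<psi> p y * w y)"
proof -
  have "\<psi> p y * w y = (1 / sqrt pi) * (poly p y * exp (- ((1 + \<delta>) * y\<^sup>2)))" for y
    by (simp add: \<psi>_def w_def algebra_simps exp_add[symmetric])
  thus ?thesis using integrable_gaussian_poly[of "1 + \<delta>" p] \<delta>_pos by (simp only: integrable_mult_right)
qed

lemma integrable_\<psi>_\<psi>: "integrable lborel (\<lambda>y. \<psi> p y * \<psi> q y * w y)"
proof -
  have "\<psi> p y * \<psi> q y * w y = (1 / sqrt pi) * (poly (p * q) y * exp (- ((1 + 2 * \<delta>) * y\<^sup>2)))" for y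
    by (simp add: \<psi>_def w_def algebra_simps exp_add[symmetric])
  thus ?thesis using integrable_gaussian_poly[of "1 + 2 * \<delta>" "p * q"] \<delta>_pos by (simp only: integrable_mult_right)
qed

lemma integrable_\<kappa>_\<psi>: "integrable lborel (\<lambda>y. \<kappa> x y * \<psi> p y * w y)"
proof (rule Bochner_Integration.integrable_bound[OF integrable_\<psi>[of p]])
  show "AE y in lborel. norm (\<kappa> x y * \<psi> p y * w y) \<le> norm (\<psi> p y * w y)"
  proof (rule AE_I2)
    fix y
    have "\<kappa> x y * \<bar>\<psi> p y * w y\<bar> \<le> 1 * \<bar>\<psi> p y * w y\<bar>"
      using \<kappa>_bounds by (intro mult_right_mono) auto
    thus "norm (\<kappa> x y * \<psi> p y * w y) \<le> norm (\<psi> p y * w y)"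
      using \<kappa>_bounds(1)[of x y] by (simp add: abs_mult)
  qed
qed (unfold \<kappa>_def, measurable)

lemma eigenfunction_exists:
  "\<exists>p. p \<noteq> 0 \<and> (\<forall>x. (\<integral>y. \<kappa> x y * \<psi> p y * w y \<partial>lborel) = (1 - \<omega>) * \<omega> ^ k * \<psi> p x)"
proof -
  let ?\<sigma> = "1 / (sqrt 2 * (1 + \<delta>))"
  have "0 < ?\<sigma>" using \<delta>_pos by simp
  from averages_to_eigenpolynomial[OF this \<omega>, of k] obtain p where p: "p \<noteq> 0"
    and avg: "averages_to \<omega> ?\<sigma> p (smult (\<omega> ^ k) p)" by blast
  have "(\<integral>y. \<kappa> x y * \<psi> p y * w y \<partial>lborel) = (1 - \<omega>) * \<omega> ^ k * \<psi> p x" for x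
  proof -
    have "\<kappa> x y * \<psi> p y * w y = (1 - \<omega>) * exp (- (\<delta> * x\<^sup>2)) * (normal_density (\<omega> * x) ?\<sigma> y * poly p y)" for y
    proof -
      have "\<kappa> x y * \<psi> p y * w y =
          (exp (- (\<delta> * (1 + \<delta>) * (x - y)\<^sup>2)) * exp (- (\<delta> * y\<^sup>2)) * (exp (- y\<^sup>2) / sqrt pi)) * poly p y"
        by (simp add: \<kappa>_def \<psi>_def w_def)
      thus ?thesis
        unfolding gaussian_kernel_completing_square[OF \<delta>_pos] \<omega>_def by (simp add: mult.assoc)
    qed
    hence "(\<integral>y. \<kappa> x y * \<psi> p y * w y \<partial>lborel) =
        (1 - \<omega>) * exp (- (\<delta> * x\<^sup>2)) * (\<integral>y. normal_density (\<omega> * x) ?\<sigma> y * poly p y \<partial>lborel)"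
      by simp
    thus ?thesis using avg by (simp add: averages_to_def \<psi>_def mult_ac)
  qed
  with p show ?thesis by blast
qed

text \<open>Integrate the symmetric kernel against both eigenfunctions and exchange the order of integration:
the integral in question is multiplied by \<open>b\<close> in one order and by \<open>a\<close> in the other.\<close>

lemma eigenfunctions_orthogonal:
  assumes p: "\<And>x. (\<integral>y. \<kappa> x y * \<psi> p y * w y \<partial>lborel) = a * \<psi> p x"
    and q: "\<And>x. (\<integral>y. \<kappa> x y * \<psi> q y * w y \<partial>lborel) = b * \<psi> q x" and "a \<noteq> b"
  shows "(\<integral>y. \<psi> p y * \<psi> q y * w y \<partial>lborel) = 0"
proof -
  define f where "f = (\<lambda>x y. (\<psi> p x * w x) * (\<psi> q y * w y))"
  define F where "F = (\<lambda>x y. \<kappa> x y * f x y)"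
  have f: "integrable (lborel \<Otimes>\<^sub>M lborel) (case_prod f)"
  proof (rule lborel_pair.Fubini_integrable)
    show "case_prod f \<in> borel_measurable (lborel \<Otimes>\<^sub>M lborel)"
      unfolding f_def by measurable
    have "integrable lborel (\<lambda>x. \<bar>\<psi> p x * w x\<bar> * (\<integral>y. \<bar>\<psi> q y * w y\<bar> \<partial>lborel))"
      by (intro integrable_mult_left integrable_abs integrable_\<psi>)
    thus "integrable lborel (\<lambda>x. \<integral>y. norm (case_prod f (x, y)) \<partial>lborel)"
      by (simp add: f_def abs_mult)
    show "AE x in lborel. integrable lborel (\<lambda>y. case_prod f (x, y))"
      using integrable_\<psi> by (simp add: f_def)
  qed
  have F: "integrable (lborel \<Otimes>\<^sub>M lborel) (case_prod F)"
  proof (rule Bochner_Integration.integrable_bound[OF f])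
    show "case_prod F \<in> borel_measurable (lborel \<Otimes>\<^sub>M lborel)"
      unfolding F_def f_def by measurable
    have "\<kappa> x y * \<bar>f x y\<bar> \<le> 1 * \<bar>f x y\<bar>" for x y
      using \<kappa>_bounds by (intro mult_right_mono) auto
    thus "AE z in lborel \<Otimes>\<^sub>M lborel. norm (case_prod F z) \<le> norm (case_prod f z)"
      using \<kappa>_bounds(1) by (intro AE_I2) (auto simp: F_def abs_mult less_imp_le)
  qed
  have "(\<integral>x. (\<integral>y. F x y \<partial>lborel) \<partial>lborel) = (\<integral>x. b * (\<psi> p x * \<psi> q x * w x) \<partial>lborel)"
  proof (intro Bochner_Integration.integral_cong refl)
    fix x
    have "(\<integral>y. F x y \<partial>lborel) = (\<integral>y. (\<psi> p x * w x) * (\<kappa> x y * \<psi> q y * w y) \<partial>lborel)"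
      by (simp add: F_def f_def mult_ac)
    thus "(\<integral>y. F x y \<partial>lborel) = b * (\<psi> p x * \<psi> q x * w x)" by (simp add: q)
  qed
  moreover have "(\<integral>y. (\<integral>x. F x y \<partial>lborel) \<partial>lborel) = (\<integral>y. a * (\<psi> p y * \<psi> q y * w y) \<partial>lborel)"
  proof (intro Bochner_Integration.integral_cong refl)
    fix y
    have "(\<integral>x. F x y \<partial>lborel) = (\<integral>x. (\<psi> q y * w y) * (\<kappa> y x * \<psi> p x * w x) \<partial>lborel)"
      by (simp add: F_def f_def \<kappa>_commute[of _ y] mult_ac)
    thus "(\<integral>x. F x y \<partial>lborel) = a * (\<psi> p y * \<psi> q y * w y)" by (simp add: p)
  qed
  moreover have "(\<integral>y. (\<integral>x. F x y \<partial>lborel) \<partial>lborel) = (\<integral>x. (\<integral>y. F x y \<partial>lborel) \<partial>lborel)"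
    by (rule lborel_pair.Fubini_integral[OF F])
  ultimately show ?thesis using \<open>a \<noteq> b\<close> by simp
qed

lemma integral_\<psi>_square_pos:
  assumes "p \<noteq> 0"
  shows "0 < (\<integral>y. \<psi> p y * \<psi> p y * w y \<partial>lborel)"
proof -
  have nonneg: "0 \<le> \<psi> p y * \<psi> p y * w y" for y using w_nonneg by simp
  have "(\<integral>y. \<psi> p y * \<psi> p y * w y \<partial>lborel) \<noteq> 0"
  proof
    assume "(\<integral>y. \<psi> p y * \<psi> p y * w y \<partial>lborel) = 0"
    hence "AE y in lborel. \<psi> p y * \<psi> p y * w y = 0"
      using integral_nonneg_eq_0_iff_AE[OF integrable_\<psi>_\<psi>] nonneg by blast
    hence "AE y in (lborel :: real measure). False"
      using AE_poly_nonzero[OF assms] by (rule eventually_elim2) (simp add: \<psi>_def w_def)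
    thus False by (simp add: AE_iff_null null_sets_def)
  qed
  moreover have "0 \<le> (\<integral>y. \<psi> p y * \<psi> p y * w y \<partial>lborel)" using nonneg by simp
  ultimately show ?thesis by linarith
qed

theorem eigenfunctions_exist:
  "\<exists>\<phi> :: nat \<Rightarrow> real \<Rightarrow> real.
    (\<forall>k. \<phi> k \<in> borel_measurable borel) \<and>
    (\<forall>i j. integrable lborel (\<lambda>y. \<phi> i y * \<phi> j y * w y)) \<and>
    (\<forall>i j. (\<integral>y. \<phi> i y * \<phi> j y * w y \<partial>lborel) = (if i = j then 1 else 0)) \<and>
    (\<forall>k x. integrable lborel (\<lambda>y. \<kappa> x y * \<phi> k y * w y)) \<and>
    (\<forall>k x. (\<integral>y. \<kappa> x y * \<phi> k y * w y \<partial>lborel) = (1 - \<omega>) * \<omega> ^ k * \<phi> k x)"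
proof -
  from eigenfunction_exists obtain p where p: "\<And>k. p k \<noteq> 0"
    and eig: "\<And>k x. (\<integral>y. \<kappa> x y * \<psi> (p k) y * w y \<partial>lborel) = (1 - \<omega>) * \<omega> ^ k * \<psi> (p k) x"
    by metis
  define N where "N = (\<lambda>k. \<integral>y. \<psi> (p k) y * \<psi> (p k) y * w y \<partial>lborel)"
  have N: "0 < N k" for k unfolding N_def using integral_\<psi>_square_pos[OF p] .
  define \<phi> where "\<phi> = (\<lambda>k y. \<psi> (p k) y / sqrt (N k))"
  have prod: "\<phi> i y * \<phi> j y * w y = (1 / (sqrt (N i) * sqrt (N j))) * (\<psi> (p i) y * \<psi> (p j) y * w y)" for i j y
    by (simp add: \<phi>_def)
  have lin: "\<kappa> x y * \<phi> k y * w y = (1 / sqrt (N k)) * (\<kappa> x y * \<psi> (p k) y * w y)" for x y k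
    by (simp add: \<phi>_def)
  show ?thesis
  proof (intro exI[of _ \<phi>] conjI allI)
    show "\<phi> k \<in> borel_measurable borel" for k unfolding \<phi>_def by measurable
    show "integrable lborel (\<lambda>y. \<phi> i y * \<phi> j y * w y)" for i j
      unfolding prod by (intro integrable_mult_right integrable_\<psi>_\<psi>)
    show "(\<integral>y. \<phi> i y * \<phi> j y * w y \<partial>lborel) = (if i = j then 1 else 0)" for i j
    proof (cases "i = j")
      case True
      have "(\<integral>y. \<phi> j y * \<phi> j y * w y \<partial>lborel) = 1 / (sqrt (N j) * sqrt (N j)) * N j"
        unfolding prod by (simp only: integral_mult_right_zero N_def)
      thus ?thesis using N[of j] True by simp
    next
      case False
      hence "\<omega> ^ i \<noteq> \<omega> ^ j"
        using power_strict_decreasing \<omega> by (metis less_irrefl linorder_neqE_nat)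
      hence "(1 - \<omega>) * \<omega> ^ i \<noteq> (1 - \<omega>) * \<omega> ^ j" using \<omega> by simp
      with eigenfunctions_orthogonal[OF eig eig] False show ?thesis unfolding prod by simp
    qed
    show "integrable lborel (\<lambda>y. \<kappa> x y * \<phi> k y * w y)" for k x
      unfolding lin by (intro integrable_mult_right integrable_\<kappa>_\<psi>)
    show "(\<integral>y. \<kappa> x y * \<phi> k y * w y \<partial>lborel) = (1 - \<omega>) * \<omega> ^ k * \<phi> k x" for k x
      unfolding lin by (simp add: eig) (simp add: \<phi>_def)
  qed
qed

end

section \<open>Tensor products\<close>

lemma space_gaussian_measure: "space (gaussian_measure d) = Rd d"
  by (simp add: gaussian_measure_def space_PiM)

context gaussian_kernel_1
begin

lemma gaussian_measure_prod:
  assumes meas: "\<And>j. f j \<in> borel_measurable borel"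
    and int: "\<And>j. integrable lborel (\<lambda>y. f j y * w y)"
  shows "integrable (gaussian_measure d) (\<lambda>x. \<Prod>j<d. f j (x j))"
    and "(\<integral>x. (\<Prod>j<d. f j (x j)) \<partial>gaussian_measure d) = (\<Prod>j<d. \<integral>y. f j y * w y \<partial>lborel)"
proof -
  interpret product_sigma_finite "\<lambda>_::nat. lborel :: real measure" ..
  let ?M = "Pi\<^sub>M {..<d} (\<lambda>_. lborel :: real measure)"
  have gm: "gaussian_measure d = density ?M (\<lambda>x. ennreal (\<Prod>j<d. w (x j)))"
    by (simp add: gaussian_measure_def w_def)
  have coord: "(\<lambda>x. g (x j)) \<in> borel_measurable ?M" if "g \<in> borel_measurable borel" "j \<in> {..<d}" for g :: "real \<Rightarrow> real" and j
  proof -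
    have "(\<lambda>x. x j) \<in> measurable ?M borel"
      using measurable_component_singleton[OF that(2), of "\<lambda>_. lborel :: real measure"] by simp
    thus ?thesis using that(1) by (rule measurable_compose)
  qed
  have F: "(\<lambda>x. \<Prod>j<d. f j (x j)) \<in> borel_measurable ?M"
    by (intro borel_measurable_prod coord meas)
  have W: "(\<lambda>x. \<Prod>j<d. w (x j)) \<in> borel_measurable ?M"
    by (intro borel_measurable_prod coord measurable_w_\<kappa>)
  have nn: "AE x in ?M. 0 \<le> (\<Prod>j<d. w (x j))"
    using w_nonneg by (intro AE_I2 prod_nonneg) simp
  have eq: "(\<Prod>j<d. w (x j)) *\<^sub>R (\<Prod>j<d. f j (x j)) = (\<Prod>j<d. (\<lambda>y. f j y * w y) (x j))" for x
    by (simp add: prod.distrib mult.commute)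
  show "integrable (gaussian_measure d) (\<lambda>x. \<Prod>j<d. f j (x j))"
    unfolding gm integrable_density[OF F W nn] eq using int by (intro product_integrable_prod) auto
  show "(\<integral>x. (\<Prod>j<d. f j (x j)) \<partial>gaussian_measure d) = (\<Prod>j<d. \<integral>y. f j y * w y \<partial>lborel)"
    unfolding gm integral_density[OF F W nn] eq using int by (intro product_integral_prod) auto
qed

lemma integral_w: "integrable lborel w" "(\<integral>y. w y \<partial>lborel) = 1"
proof -
  have eq: "w = normal_density 0 (1 / sqrt 2)"
    by (auto simp: w_def normal_density_def power_divide)
  show "integrable lborel w" "(\<integral>y. w y \<partial>lborel) = 1"
    unfolding eq by (rule integrable_normal_density integral_normal_density; simp)+
qed

lemma gaussian_kernel_eq_prod:
  assumes "\<gamma>\<^sup>2 = \<delta> * (1 + \<delta>)"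
  shows "gaussian_kernel \<gamma> d t s = (\<Prod>j<d. \<kappa> (t j) (s j))"
  by (simp add: gaussian_kernel_def \<kappa>_def assms)

end

lemma gaussian_kernel_commute: "gaussian_kernel \<gamma> d t s = gaussian_kernel \<gamma> d s t"
  by (simp add: gaussian_kernel_def power2_commute)

lemma gaussian_kernel_diagonal: "gaussian_kernel \<gamma> d t t = 1"
  by (simp add: gaussian_kernel_def)

text \<open>The elements of \<open>H\<close> are continuous. Composed with the projection that replaces the coordinates from
\<open>d\<close> on by \<open>undefined\<close>, they become continuous functions of all sequences, where the
product \<open>\<sigma>\<close>-algebra is the Borel \<open>\<sigma>\<close>-algebra.\<close>

lemma gaussian_rkhs_measurable:
  assumes "rkhs (Rd d) (gaussian_kernel \<gamma> d) H ip" and f: "f \<in> H"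
  shows "f \<in> borel_measurable (gaussian_measure d)"
proof -
  interpret rkhs "Rd d" "gaussian_kernel \<gamma> d" H ip by fact
  define E :: "(nat \<Rightarrow> real) \<Rightarrow> nat \<Rightarrow> real" where "E = (\<lambda>x. restrict x {..<d})"
  have E: "E x \<in> Rd d" for x by (simp add: E_def)
  have cont: "continuous_on UNIV (\<lambda>x. f (E x))"
    unfolding continuous_on_def
  proof
    fix x :: "nat \<Rightarrow> real"
    have "continuous_on UNIV (\<lambda>y. gaussian_kernel \<gamma> d y x)"
      unfolding gaussian_kernel_def by (intro continuous_intros continuous_on_product_coordinates)
    hence "((\<lambda>y. gaussian_kernel \<gamma> d y x) \<longlongrightarrow> gaussian_kernel \<gamma> d x x) (at x within UNIV)"
      by (auto simp: continuous_on_def)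
    hence "((\<lambda>y. sqrt (ip f f * (2 - 2 * gaussian_kernel \<gamma> d y x))) \<longlongrightarrow>
              sqrt (ip f f * (2 - 2 * gaussian_kernel \<gamma> d x x))) (at x within UNIV)"
      by (intro tendsto_intros)
    hence lim: "((\<lambda>y. sqrt (ip f f * (2 - 2 * gaussian_kernel \<gamma> d y x))) \<longlongrightarrow> 0) (at x within UNIV)"
      by (simp add: gaussian_kernel_diagonal)
    have bound: "norm (f (E y) - f (E x)) \<le> sqrt (ip f f * (2 - 2 * gaussian_kernel \<gamma> d y x))" for y
    proof -
      have "gaussian_kernel \<gamma> d (E x) (E y) = gaussian_kernel \<gamma> d y x"
        by (subst gaussian_kernel_commute) (simp add: gaussian_kernel_def E_def)
      hence "(f (E y) - f (E x))\<^sup>2 \<le> ip f f * (2 - 2 * gaussian_kernel \<gamma> d y x)"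
        using eval_diff_square_le[OF E E f, of y x] by (simp add: gaussian_kernel_diagonal algebra_simps)
      thus ?thesis using real_le_rsqrt[of "\<bar>f (E y) - f (E x)\<bar>"] by simp
    qed
    have "((\<lambda>y. f (E y) - f (E x)) \<longlongrightarrow> 0) (at x within UNIV)"
      by (rule Lim_null_comparison[OF _ lim]) (use bound in \<open>auto intro: always_eventually\<close>)
    thus "((\<lambda>y. f (E y)) \<longlongrightarrow> f (E x)) (at x within UNIV)"
      by (simp add: LIM_zero_iff)
  qed
  let ?M = "Pi\<^sub>M {..<d} (\<lambda>_. lborel :: real measure)"
  have "(\<lambda>x. x) \<in> measurable ?M (Pi\<^sub>M UNIV (\<lambda>_. borel :: real measure))"
  proof (rule measurable_PiM_single')
    fix i :: nat
    show "(\<lambda>x. x i) \<in> measurable ?M (borel :: real measure)"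
    proof (cases "i < d")
      case True
      thus ?thesis
        using measurable_component_singleton[of i "{..<d}" "\<lambda>_. lborel :: real measure"] by simp
    next
      case False
      have "x i = undefined" if "x \<in> space ?M" for x
        using that False by (auto simp: space_PiM PiE_def extensional_def)
      thus ?thesis by (subst measurable_cong[where g = "\<lambda>_. undefined"]) auto
    qed
  qed auto
  hence "(\<lambda>x. x) \<in> measurable ?M borel"
    by (simp cong: measurable_cong_sets add: sets_PiM_equal_borel)
  from measurable_compose[OF this borel_measurable_continuous_onI[OF cont]]
  have "(\<lambda>x. f (E x)) \<in> borel_measurable ?M" .
  moreover have "f (E x) = f x" if "x \<in> space ?M" for x
  proof -
    have "E x = x" using that by (auto simp: E_def space_PiM PiE_def extensional_restrict)
    thus ?thesis by simp
  qed
  ultimately have "f \<in> borel_measurable ?M"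
    by (simp cong: measurable_cong)
  thus ?thesis by (simp add: gaussian_measure_def)
qed

text \<open>The part of the trace that is captured by the multi-indices with entries below \<open>N\<close>.\<close>

lemma sum_geometric_products:
  fixes \<omega> :: real
  shows "(\<Sum>k\<in>PiE {..<d} (\<lambda>_. {..<N}). \<Prod>j<d. (1 - \<omega>) * \<omega> ^ k j) = (1 - \<omega> ^ N) ^ d"
proof -
  have "(\<Sum>k\<in>PiE {..<d} (\<lambda>_. {..<N}). \<Prod>j<d. (1 - \<omega>) * \<omega> ^ k j) = (\<Prod>j<d. \<Sum>i<N. (1 - \<omega>) * \<omega> ^ i)"
    by (subst prod_sum_PiE) auto
  also have "(\<Sum>i<N. (1 - \<omega>) * \<omega> ^ i) = 1 - \<omega> ^ N"
    by (induction N) (simp_all add: algebra_simps)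
  finally show ?thesis by simp
qed

context gaussian_kernel_1
begin

definition eigenvalue :: "nat \<Rightarrow> (nat \<Rightarrow> nat) \<Rightarrow> real" where
  "eigenvalue d k = (\<Prod>j<d. (1 - \<omega>) * \<omega> ^ k j)"

lemma eigenvalue_eq: "eigenvalue d k = (1 - \<omega>) ^ d * \<omega> ^ (\<Sum>j<d. k j)"
  by (simp add: eigenvalue_def prod.distrib power_sum)

text \<open>The kernel, the measure and the eigenfunctions are products, so every integral factorises into
univariate ones. The trace equals one because the kernel is one on the diagonal.\<close>

theorem gaussian_kernel_eigensystem:
  assumes \<gamma>: "\<gamma>\<^sup>2 = \<delta> * (1 + \<delta>)" and H: "rkhs (Rd d) (gaussian_kernel \<gamma> d) H ip"
  obtains \<phi> where
    "kernel_eigensystem (Rd d) (gaussian_kernel \<gamma> d) H ip (gaussian_measure d)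
       (PiE {..<d} (\<lambda>_. UNIV)) \<phi> (eigenvalue d)"
proof -
  from eigenfunctions_exist obtain \<phi> :: "nat \<Rightarrow> real \<Rightarrow> real" where \<phi>:
    "(\<forall>k. \<phi> k \<in> borel_measurable borel) \<and>
     (\<forall>i j. integrable lborel (\<lambda>y. \<phi> i y * \<phi> j y * w y)) \<and>
     (\<forall>i j. (\<integral>y. \<phi> i y * \<phi> j y * w y \<partial>lborel) = (if i = j then 1 else 0)) \<and>
     (\<forall>k x. integrable lborel (\<lambda>y. \<kappa> x y * \<phi> k y * w y)) \<and>
     (\<forall>k x. (\<integral>y. \<kappa> x y * \<phi> k y * w y \<partial>lborel) = (1 - \<omega>) * \<omega> ^ k * \<phi> k x)"
    by (rule exE)
  note meas = \<phi>[THEN conjunct1, rule_format]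
    and int = \<phi>[THEN conjunct2, THEN conjunct1, rule_format]
    and orth = \<phi>[THEN conjunct2, THEN conjunct2, THEN conjunct1, rule_format]
    and int_\<kappa> = \<phi>[THEN conjunct2, THEN conjunct2, THEN conjunct2, THEN conjunct1, rule_format]
    and eig = \<phi>[THEN conjunct2, THEN conjunct2, THEN conjunct2, THEN conjunct2, rule_format]
  define \<Phi> where "\<Phi> = (\<lambda>k (x :: nat \<Rightarrow> real). \<Prod>j<d. \<phi> (k j :: nat) (x j))"
  have diag: "gaussian_kernel \<gamma> d x x = (\<Prod>j<d. (\<lambda>_. 1) (x j))" for x
    by (simp add: gaussian_kernel_diagonal)
  have one: "integrable (gaussian_measure d) (\<lambda>x. gaussian_kernel \<gamma> d x x)"
    unfolding diag by (rule gaussian_measure_prod(1)) (simp_all add: integral_w)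
  have "(\<integral>x. gaussian_kernel \<gamma> d x x \<partial>gaussian_measure d) = (\<Prod>j<d. \<integral>y. 1 * w y \<partial>lborel)"
    unfolding diag by (rule gaussian_measure_prod(2)) (simp_all add: integral_w)
  hence trace: "(\<integral>x. gaussian_kernel \<gamma> d x x \<partial>gaussian_measure d) = 1"
    by (simp add: integral_w)
  have prod_eq: "\<Phi> k x * \<Phi> l x = (\<Prod>j<d. (\<lambda>y. \<phi> (k j) y * \<phi> (l j) y) (x j))" for k l x
    by (simp add: \<Phi>_def prod.distrib)
  have prod_meas: "(\<lambda>y. \<phi> i y * \<phi> j y) \<in> borel_measurable borel" for i j
    using meas by (intro borel_measurable_times)
  have eigen_eq: "gaussian_kernel \<gamma> d y x * \<Phi> k y = (\<Prod>j<d. (\<lambda>y. \<kappa> (x j) y * \<phi> (k j) y) (y j))" for k x y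
    by (simp add: gaussian_kernel_eq_prod[OF \<gamma>] \<Phi>_def prod.distrib \<kappa>_commute)
  have eigen_meas: "(\<lambda>y. \<kappa> x y * \<phi> k y) \<in> borel_measurable borel" for x k
  proof -
    have "(\<lambda>y. \<kappa> x y) \<in> borel_measurable borel" unfolding \<kappa>_def by measurable
    thus ?thesis using meas by (intro borel_measurable_times)
  qed
  interpret rkhs "Rd d" "gaussian_kernel \<gamma> d" H ip by (rule H)
  have "kernel_eigensystem (Rd d) (gaussian_kernel \<gamma> d) H ip (gaussian_measure d)
          (PiE {..<d} (\<lambda>_. UNIV)) \<Phi> (eigenvalue d)"
  proof
    show "space (gaussian_measure d) = Rd d" by (rule space_gaussian_measure)
    show "f \<in> borel_measurable (gaussian_measure d)" if "f \<in> H" for f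
      by (rule gaussian_rkhs_measurable[OF H that])
    show "integrable (gaussian_measure d) (\<lambda>x. gaussian_kernel \<gamma> d x x)" by (rule one)
    fix k :: "nat \<Rightarrow> nat" assume k: "k \<in> PiE {..<d} (\<lambda>_. UNIV)"
    show "square_integrable (gaussian_measure d) (\<Phi> k)"
      unfolding square_integrable_def
    proof
      show "\<Phi> k \<in> borel_measurable (gaussian_measure d)"
        unfolding \<Phi>_def gaussian_measure_def measurable_density_eq1
        by (intro borel_measurable_prod measurable_compose[OF _ meas])
          (auto intro!: measurable_compose[OF measurable_component_singleton])
      show "integrable (gaussian_measure d) (\<lambda>x. (\<Phi> k x)\<^sup>2)"
        unfolding power2_eq_square prod_eq by (rule gaussian_measure_prod(1)[OF prod_meas int])
    qed
    show "0 < eigenvalue d k" using \<omega> by (simp add: eigenvalue_eq)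
    show "(\<integral>y. gaussian_kernel \<gamma> d y x * \<Phi> k y \<partial>gaussian_measure d) = eigenvalue d k * \<Phi> k x" for x
    proof -
      have "(\<integral>y. gaussian_kernel \<gamma> d y x * \<Phi> k y \<partial>gaussian_measure d) =
              (\<Prod>j<d. (1 - \<omega>) * \<omega> ^ k j * \<phi> (k j) (x j))"
        unfolding eigen_eq gaussian_measure_prod(2)[OF eigen_meas int_\<kappa>] eig by simp
      thus ?thesis by (simp add: eigenvalue_def \<Phi>_def prod.distrib)
    qed
    fix l :: "nat \<Rightarrow> nat" assume l: "l \<in> PiE {..<d} (\<lambda>_. UNIV)"
    have "(\<integral>x. \<Phi> k x * \<Phi> l x \<partial>gaussian_measure d) = (\<Prod>j<d. if k j = l j then 1 else 0)"
      unfolding prod_eq gaussian_measure_prod(2)[OF prod_meas int] orth by simp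
    also have "\<dots> = (if k = l then 1 else 0)"
    proof (cases "k = l")
      case False
      then obtain j where "j < d" "k j \<noteq> l j" using PiE_ext[OF k l] by auto
      thus ?thesis using False by (auto intro!: prod_zero)
    qed simp
    finally show "(\<integral>x. \<Phi> k x * \<Phi> l x \<partial>gaussian_measure d) = (if k = l then 1 else 0)" .
  next
    fix e :: real assume "0 < e"
    have "(\<lambda>N. (1 - \<omega> ^ N) ^ d) \<longlonglongrightarrow> (1 - 0) ^ d"
      using \<omega> by (intro tendsto_intros LIMSEQ_realpow_zero) auto
    hence "eventually (\<lambda>N. 1 - e < (1 - \<omega> ^ N) ^ d) sequentially"
      using \<open>0 < e\<close> by (intro order_tendstoD(1)) auto
    then obtain N where N: "1 - e < (1 - \<omega> ^ N) ^ d"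
      by (auto simp: eventually_sequentially)
    show "\<exists>F. finite F \<and> F \<subseteq> PiE {..<d} (\<lambda>_. UNIV) \<and>
            (\<integral>x. gaussian_kernel \<gamma> d x x \<partial>gaussian_measure d) - e \<le> (\<Sum>k\<in>F. eigenvalue d k)"
    proof (intro exI conjI)
      show "finite (PiE {..<d} (\<lambda>_. {..<N}))" by (intro finite_PiE) auto
      show "PiE {..<d} (\<lambda>_. {..<N}) \<subseteq> PiE {..<d} (\<lambda>_. UNIV)" by (intro PiE_mono) auto
      show "(\<integral>x. gaussian_kernel \<gamma> d x x \<partial>gaussian_measure d) - e
              \<le> (\<Sum>k\<in>PiE {..<d} (\<lambda>_. {..<N}). eigenvalue d k)"
        unfolding trace eigenvalue_def sum_geometric_products using N by simp
    qed
  qed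
  thus ?thesis by (rule that)
qed

end

text \<open>Multi-indices are lists of length \<open>d\<close>; the lists with a prescribed sum are counted by a binomial
coefficient, and these are summed by the hockey-stick identity.\<close>

lemma card_multi_indices:
  fixes m :: nat
  assumes "0 < d"
  defines "S \<equiv> {k \<in> PiE {..<d} (\<lambda>_. UNIV :: nat set). (\<Sum>j<d. k j) \<le> m}"
  shows "finite S" "card S = (d + m) choose d"
proof -
  define L where "L = {l :: nat list. length l = d \<and> sum_list l \<le> m}"
  have "L \<subseteq> {l. set l \<subseteq> {..m} \<and> length l = d}"
    by (auto simp: L_def dest!: member_le_sum_list)
  hence fin: "finite L" using finite_lists_length_eq[of "{..m}" d] by (rule finite_subset) simp
  have bij: "bij_betw (\<lambda>k. map k [0..<d]) S L"
  proof (rule bij_betw_byWitness[where f' = "\<lambda>l. restrict (\<lambda>j. l ! j) {..<d}"])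
    show "\<forall>k\<in>S. restrict (\<lambda>j. map k [0..<d] ! j) {..<d} = k"
      by (auto simp: S_def fun_eq_iff PiE_def extensional_def)
    show "\<forall>l\<in>L. map (restrict (\<lambda>j. l ! j) {..<d}) [0..<d] = l"
      by (auto simp: L_def intro!: nth_equalityI)
    have "sum_list (map k [0..<d]) = (\<Sum>j<d. k j)" for k :: "nat \<Rightarrow> nat"
      by (simp only: interv_sum_list_conv_sum_set_nat set_upt atLeast0LessThan)
    thus "(\<lambda>k. map k [0..<d]) ` S \<subseteq> L"
      by (auto simp: S_def L_def)
    have "(\<Sum>j<d. restrict (\<lambda>j. l ! j) {..<d} j) = sum_list l" if "length l = d" for l :: "nat list"
      unfolding sum_list_sum_nth that atLeast0LessThan by (intro sum.cong) auto
    thus "(\<lambda>l. restrict (\<lambda>j. l ! j) {..<d}) ` L \<subseteq> S"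
      by (auto simp: S_def L_def split: if_splits)
  qed
  show "finite S" using bij fin bij_betw_finite by blast
  have "L = (\<Union>N\<le>m. {l. length l = d \<and> sum_list l = N})" by (auto simp: L_def)
  moreover have "finite {l. length l = d \<and> sum_list l = N}" if "N \<le> m" for N
    using fin that by (rule_tac finite_subset[of _ L]) (auto simp: L_def)
  ultimately have "card L = (\<Sum>N\<le>m. card {l :: nat list. length l = d \<and> sum_list l = N})"
    by (simp only:) (subst card_UN_disjoint, auto)
  also have "\<dots> = (\<Sum>N\<le>m. (d - 1 + N) choose N)"
    using assms(1) by (intro sum.cong refl) (simp add: card_length_sum_list add.commute)
  also have "\<dots> = (d + m) choose m"
    unfolding sum_choose_lower using assms(1) by simp
  also have "\<dots> = (d + m) choose d"
    using binomial_symmetric[of m "d + m"] by simp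
  finally show "card S = (d + m) choose d"
    using bij_betw_same_card[OF bij] by simp
qed

lemma omega_bounds:
  assumes "0 < \<gamma>"
  defines "\<delta> \<equiv> (sqrt (1 + 4 * \<gamma>\<^sup>2) - 1) / 2"
  shows "0 < \<delta>" "\<gamma>\<^sup>2 = \<delta> * (1 + \<delta>)" "omega \<gamma> = \<delta> / (1 + \<delta>)" "0 < omega \<gamma>" "omega \<gamma> < 1"
proof -
  define s where "s = sqrt (1 + 4 * \<gamma>\<^sup>2)"
  have s: "s\<^sup>2 = 1 + 4 * \<gamma>\<^sup>2" by (simp add: s_def add_nonneg_nonneg)
  have "1 < s" unfolding s_def using assms(1) by simp
  have sd: "s = 1 + 2 * \<delta>" by (simp add: \<delta>_def s_def field_simps)
  show d: "0 < \<delta>" using \<open>1 < s\<close> sd by simp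
  have "4 * \<gamma>\<^sup>2 = (1 + 2 * \<delta>)\<^sup>2 - 1" using s sd by simp
  also have "\<dots> = 4 * (\<delta> * (1 + \<delta>))" by (simp add: power2_eq_square algebra_simps)
  finally show g: "\<gamma>\<^sup>2 = \<delta> * (1 + \<delta>)" by simp
  have "omega \<gamma> = 2 * (\<delta> * (1 + \<delta>)) / (1 + 2 * (\<delta> * (1 + \<delta>)) + (1 + 2 * \<delta>))"
    unfolding omega_def using sd g s_def by metis
  also have "\<dots> = (2 * (1 + \<delta>) * \<delta>) / (2 * (1 + \<delta>) * (1 + \<delta>))"
    by (simp add: algebra_simps)
  finally have "omega \<gamma> = (2 * (1 + \<delta>) * \<delta>) / (2 * (1 + \<delta>) * (1 + \<delta>))" .
  thus w: "omega \<gamma> = \<delta> / (1 + \<delta>)" using d by simp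
  show "0 < omega \<gamma>" "omega \<gamma> < 1" unfolding w using d by auto
qed

text \<open>An eigenvalue exceeds \<open>\<epsilon>\<^sup>2\<close> times the largest one, which belongs to the zero multi-index, iff
\<open>\<omega>\<close> to the power \<open>\<bar>k\<bar>\<close> exceeds \<open>\<epsilon>\<^sup>2\<close>, that is iff \<open>\<bar>k\<bar> < c\<^sub>\<omega> \<bar>ln \<epsilon>\<^sup>2\<bar>\<close>. The bound is strict, so \<open>m\<close> is the largest integer strictly
below it.\<close>

theorem gaussian_info_complexity:
  assumes \<gamma>: "0 < \<gamma>" and d: "0 < d" and H: "rkhs (Rd d) (gaussian_kernel \<gamma> d) H ip"
    and \<epsilon>: "0 < \<epsilon>" "\<epsilon> < 1"
    and m: "real m < c_omega \<gamma> * \<bar>ln (\<epsilon>\<^sup>2)\<bar>" "c_omega \<gamma> * \<bar>ln (\<epsilon>\<^sup>2)\<bar> \<le> real m + 1"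
  shows "info_complexity H ip d \<epsilon> = (d + m) choose d"
proof -
  define \<delta> where "\<delta> = (sqrt (1 + 4 * \<gamma>\<^sup>2) - 1) / 2"
  note om = omega_bounds[OF \<gamma>, folded \<delta>_def]
  interpret gaussian_kernel_1 \<delta> by standard (rule om)
  have \<omega>_eq: "omega \<gamma> = \<omega>" by (simp add: om(3) \<omega>_def)
  obtain \<phi> where sys: "kernel_eigensystem (Rd d) (gaussian_kernel \<gamma> d) H ip (gaussian_measure d)
       (PiE {..<d} (\<lambda>_. UNIV)) \<phi> (eigenvalue d)"
    using gaussian_kernel_eigensystem[OF om(2) H] by blast
  define S where "S = {k \<in> PiE {..<d} (\<lambda>_. UNIV :: nat set). (\<Sum>j<d. k j) \<le> m}"
  define origin where "origin = restrict (\<lambda>_. 0 :: nat) {..<d}"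
  have origin_sum: "(\<Sum>j<d. origin j) = 0" by (simp add: origin_def)
  have "origin \<in> S" using origin_sum by (auto simp: S_def origin_def)
  have threshold: "\<epsilon>\<^sup>2 * eigenvalue d origin < eigenvalue d k \<longleftrightarrow> (\<Sum>j<d. k j) \<le> m" for k
  proof -
    let ?s = "\<Sum>j<d. k j"
    have ln\<omega>: "ln \<omega> < 0" using \<omega> by simp
    have "\<epsilon>\<^sup>2 < 1" using \<epsilon> by (simp add: power_less_one_iff)
    hence ln\<epsilon>: "ln (\<epsilon>\<^sup>2) < 0" using \<epsilon> by simp
    have "0 < (1 - \<omega>) ^ d" using \<omega> by simp
    hence "\<epsilon>\<^sup>2 * eigenvalue d origin < eigenvalue d k \<longleftrightarrow> \<epsilon>\<^sup>2 < \<omega> ^ ?s"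
      by (simp add: eigenvalue_eq origin_sum mult.commute)
    also have "\<dots> \<longleftrightarrow> ln (\<epsilon>\<^sup>2) < ln (\<omega> ^ ?s)"
      using \<epsilon> \<omega> by (intro ln_less_cancel_iff[symmetric]) auto
    also have "ln (\<omega> ^ ?s) = real ?s * ln \<omega>" using \<omega> by (simp add: ln_realpow)
    also have "ln (\<epsilon>\<^sup>2) < real ?s * ln \<omega> \<longleftrightarrow> real ?s < c_omega \<gamma> * \<bar>ln (\<epsilon>\<^sup>2)\<bar>"
      using ln\<omega> ln\<epsilon> by (simp add: c_omega_def \<omega>_eq field_simps)
    also have "\<dots> \<longleftrightarrow> ?s \<le> m"
      using m by linarith
    finally show ?thesis .
  qed
  have le_origin: "eigenvalue d k \<le> eigenvalue d origin" for k
    using \<omega> by (simp add: eigenvalue_eq origin_sum power_le_one mult_left_le)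
  have "info_complexity H ip d \<epsilon> = card S"
  proof (rule info_complexity_eq_card[OF sys])
    show "origin \<in> S" by fact
    show "0 < \<epsilon>" by (rule \<epsilon>)
    show "eigenvalue d k \<le> eigenvalue d origin" for k by (rule le_origin)
    show "finite S" unfolding S_def by (rule card_multi_indices(1)[OF d])
    show "S \<subseteq> PiE {..<d} (\<lambda>_. UNIV)" by (auto simp: S_def)
    show "\<epsilon>\<^sup>2 * eigenvalue d origin < eigenvalue d k" if "k \<in> S" for k
      using that threshold by (simp add: S_def)
    show "eigenvalue d k \<le> \<epsilon>\<^sup>2 * eigenvalue d origin" if "k \<in> PiE {..<d} (\<lambda>_. UNIV) - S" for k
      using that threshold[of k] by (simp add: S_def not_less[symmetric])
  qed
  thus ?thesis unfolding S_def by (simp add: card_multi_indices(2)[OF d])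
qed

section \<open>Binomial coefficients and the entropy function\<close>

text \<open>This is \<open>a + b\<close> times the entropy (in nats) of a coin with bias \<open>a / (a + b)\<close>.\<close>

definition entropy :: "real \<Rightarrow> real \<Rightarrow> real" where
  "entropy a b = a * ln (1 + b / a) + b * ln (1 + a / b)"

lemma ln_one_plus_divide:
  fixes a b :: real
  assumes "0 < a" "0 \<le> b"
  shows "ln (1 + b / a) = ln (a + b) - ln a"
proof -
  have "1 + b / a = (a + b) / a" using assms by (simp add: field_simps)
  thus ?thesis using assms by (simp add: ln_div)
qed

text \<open>Concavity in the second argument: as a function of \<open>b\<close>, the right-hand side is the tangent at \<open>y\<close>.\<close>

lemma entropy_le_tangent:
  fixes a b y :: real
  assumes "0 < a" "0 < b" "0 < y"
  shows "entropy a b \<le> a * ln (1 + y / a) + b * ln (1 + a / y)"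
proof -
  have 1: "ln (1 + b / a) - ln (1 + y / a) \<le> (a + b) / (a + y) - 1"
  proof -
    have "ln (1 + b / a) - ln (1 + y / a) = ln ((a + b) / (a + y))"
      using assms by (simp add: ln_div ln_one_plus_divide)
    also have "ln ((a + b) / (a + y)) \<le> (a + b) / (a + y) - 1"
      using assms by (intro ln_le_minus_one) simp
    finally show ?thesis .
  qed
  have 2: "ln (1 + a / b) - ln (1 + a / y) \<le> ((a + b) * y) / (b * (a + y)) - 1"
  proof -
    have "ln (1 + a / b) - ln (1 + a / y) = ln (((a + b) * y) / (b * (a + y)))"
      using assms by (simp add: ln_div ln_mult ln_one_plus_divide add.commute)
    also have "\<dots> \<le> ((a + b) * y) / (b * (a + y)) - 1"
      using assms by (intro ln_le_minus_one) simp
    finally show ?thesis .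
  qed
  have "a * ((a + b) / (a + y) - 1) + b * (((a + b) * y) / (b * (a + y)) - 1) = 0"
    using assms by (simp add: divide_simps) (simp add: algebra_simps)
  moreover have "a * (ln (1 + b / a) - ln (1 + y / a)) \<le> a * ((a + b) / (a + y) - 1)"
    using 1 assms by (intro mult_left_mono) auto
  moreover have "b * (ln (1 + a / b) - ln (1 + a / y)) \<le> b * (((a + b) * y) / (b * (a + y)) - 1)"
    using 2 assms by (intro mult_left_mono) auto
  ultimately show ?thesis
    by (simp add: entropy_def algebra_simps)
qed

text \<open>A single term of the binomial expansion of \<open>(p + q) ^ (d + k) = 1\<close> is at most one. Taking \<open>p\<close>
proportional to \<open>d\<close> and \<open>q\<close> proportional to \<open>x\<close>, rather than to \<open>k\<close>, gives the bound in terms of \<open>x\<close>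
directly.\<close>

lemma ln_binomial_le_entropy:
  fixes d k :: nat and x :: real
  assumes "0 < d" "0 < x" "real k \<le> x"
  shows "ln (real ((d + k) choose d)) \<le> entropy (real d) x"
proof -
  define p where "p = real d / (real d + x)"
  define q where "q = x / (real d + x)"
  have pq: "p + q = 1" "0 < p" "0 < q"
    using assms by (auto simp: p_def q_def add_pos_pos simp flip: add_divide_distrib)
  have "real ((d + k) choose d) * p ^ d * q ^ (d + k - d)
        \<le> (\<Sum>i\<le>d + k. real ((d + k) choose i) * p ^ i * q ^ (d + k - i))"
    using pq by (intro member_le_sum) auto
  also have "\<dots> = 1"
    using binomial_ring[of p q "d + k"] pq by simp
  finally have le: "real ((d + k) choose d) * (p ^ d * q ^ k) \<le> 1"
    by (simp add: mult.assoc)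
  have "ln (real ((d + k) choose d) * (p ^ d * q ^ k)) \<le> ln 1"
    using le pq by (subst ln_le_cancel_iff) auto
  hence "ln (real ((d + k) choose d)) + (real d * ln p + real k * ln q) \<le> 0"
    using pq by (simp add: ln_mult ln_realpow)
  moreover have "ln p = - ln (1 + x / d)" "ln q = - ln (1 + d / x)"
  proof -
    have "p = inverse (1 + x / d)" "q = inverse (1 + d / x)"
      using assms by (auto simp: p_def q_def field_simps)
    thus "ln p = - ln (1 + x / d)" "ln q = - ln (1 + d / x)"
      using assms by (simp_all add: ln_inverse add_pos_pos)
  qed
  ultimately have "ln (real ((d + k) choose d)) \<le> real d * ln (1 + x / d) + real k * ln (1 + d / x)"
    by simp
  also have "real k * ln (1 + d / x) \<le> x * ln (1 + d / x)"
    using assms by (intro mult_right_mono) auto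
  finally show ?thesis
    by (simp add: entropy_def)
qed

text \<open>The logarithm of \<open>n! * e ^ n / n ^ n\<close>. By Stirling's formula it is half the logarithm of \<open>2 * pi * n\<close>
up to a vanishing term.\<close>

definition stirling_excess :: "nat \<Rightarrow> real" where
  "stirling_excess n = ln (fact n) + real n - real n * ln (real n)"

lemma stirling_excess_Suc:
  assumes "0 < n"
  shows "stirling_excess n \<le> stirling_excess (Suc n)"
    and "stirling_excess (Suc n) - ln (Suc n) \<le> stirling_excess n - ln n"
proof -
  let ?L = "ln (real (Suc n)) - ln (real n)"
  have eq: "stirling_excess (Suc n) = stirling_excess n + (1 - real n * ?L)"
    using assms by (simp add: stirling_excess_def ln_mult algebra_simps del: of_nat_Suc)
      (simp add: algebra_simps)
  have L: "?L = ln (1 + 1 / real n)"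
    using assms ln_one_plus_divide[of "real n" 1] by (simp add: add.commute)
  have "?L \<le> 1 / real n"
    unfolding L using assms by (intro ln_add_one_self_le_self) auto
  hence "real n * ?L \<le> 1"
    using assms by (simp add: field_simps)
  thus "stirling_excess n \<le> stirling_excess (Suc n)"
    using eq by linarith
  have "- ?L \<le> real n / real (Suc n) - 1"
    using ln_le_minus_one[of "real n / real (Suc n)"] assms by (simp add: ln_div)
  hence "1 / real (Suc n) \<le> ?L"
    by (simp add: field_simps)
  hence "1 \<le> real (Suc n) * ?L"
    by (simp add: field_simps)
  hence "1 - real n * ?L \<le> ?L"
    by (simp add: algebra_simps)
  thus "stirling_excess (Suc n) - ln (Suc n) \<le> stirling_excess n - ln n"
    using eq by linarith
qed

lemma stirling_excess_mono:
  assumes "0 < m" "m \<le> n"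
  shows "stirling_excess m \<le> stirling_excess n"
  using assms(2)
proof (induction rule: dec_induct)
  case (step n)
  thus ?case using stirling_excess_Suc(1)[of n] assms(1) by simp
qed simp

lemma stirling_excess_le:
  assumes "0 < n"
  shows "stirling_excess n \<le> 1 + ln n"
proof -
  have "Suc 0 \<le> n" using assms by simp
  hence "stirling_excess n - ln n \<le> 1"
  proof (induction rule: dec_induct)
    case base
    show ?case by (simp add: stirling_excess_def)
  next
    case (step k)
    thus ?case using stirling_excess_Suc(2)[of k] by simp
  qed
  thus ?thesis by simp
qed

lemma ln_binomial_eq_entropy:
  assumes "0 < d" "0 < k"
  shows "ln (real ((d + k) choose d)) =
           entropy d k + stirling_excess (d + k) - stirling_excess d - stirling_excess k"
proof -
  have "real ((d + k) choose d) = fact (d + k) / (fact d * fact k)"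
    by (simp add: binomial_fact)
  hence "ln (real ((d + k) choose d)) = ln (fact (d + k)) - ln (fact d) - ln (fact k)"
    by (simp add: ln_div ln_mult)
  moreover have ln_eqs: "ln (1 + real k / real d) = ln (real d + real k) - ln (real d)"
    "ln (1 + real d / real k) = ln (real d + real k) - ln (real k)"
    using assms by (simp_all add: ln_one_plus_divide add.commute)
  ultimately show ?thesis
    unfolding stirling_excess_def entropy_def ln_eqs of_nat_add by algebra
qed

text \<open>The loss is logarithmic in the smaller one of \<open>d\<close> and \<open>k\<close>. A loss logarithmic in \<open>d + k\<close> would be
too large below: it need not be small compared with \<open>d\<close> if \<open>k\<close> grows very fast.\<close>

lemma entropy_le_ln_binomial:
  assumes "0 < d" "0 < k"
  shows "entropy d k - 1 - ln (min d k) \<le> ln (real ((d + k) choose d))"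
proof -
  have "stirling_excess d \<le> stirling_excess (d + k)" "stirling_excess k \<le> stirling_excess (d + k)"
    using assms by (auto intro!: stirling_excess_mono)
  moreover have "stirling_excess d \<le> 1 + ln d" "stirling_excess k \<le> 1 + ln k"
    using assms by (auto intro!: stirling_excess_le)
  ultimately show ?thesis
    using ln_binomial_eq_entropy[OF assms] by (simp add: min_def)
qed

text \<open>The factor in parentheses tends to zero when \<open>d\<close> and \<open>x\<close> tend to infinity, in whatever relation to
each other. The first summand comes from replacing \<open>k\<close> by \<open>x\<close>, the second one from the
Stirling-type bound.\<close>

lemma ln_binomial_entropy_error:
  fixes d :: nat and x D :: real
  defines "D \<equiv> x * ln (1 + d / x)"
  assumes "0 < d" "2 \<le> x" "real k < x" "x \<le> real k + 1"
  shows "\<bar>ln (real ((d + k) choose d)) - entropy d x\<bar>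
           \<le> (2 / x + (1 + ln (min d x)) / (min d x / 2)) * D"
proof -
  let ?\<mu> = "min (real d) x"
  have k: "0 < k" "x / 2 \<le> k" using assms by linarith+
  have \<mu>: "1 \<le> ?\<mu>" using assms by auto
  have "entropy d x \<le> d * ln (1 + k / d) + x * ln (1 + d / k)"
    using assms k by (intro entropy_le_tangent) auto
  also have "\<dots> = entropy d k + (x - k) * ln (1 + d / k)"
    by (simp add: entropy_def algebra_simps)
  also have "(x - k) * ln (1 + d / k) \<le> 1 * ln (1 + d / k)"
    using assms k by (intro mult_right_mono) auto
  finally have low: "entropy d x - ln (real ((d + k) choose d)) \<le> ln (1 + d / k) + 1 + ln (min d k)"
    using entropy_le_ln_binomial[of d k] assms k by simp
  have "ln (1 + d / k) \<le> 2 * ln (1 + d / x)"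
  proof -
    have "d / k \<le> d / (x / 2)"
      using assms k by (intro divide_left_mono) auto
    hence "1 + d / k \<le> 1 + 2 * (d / x)" by (simp add: mult.commute)
    also have "\<dots> \<le> (1 + d / x)\<^sup>2" using assms by (simp add: power2_eq_square algebra_simps)
    finally have "1 + d / k \<le> (1 + d / x)\<^sup>2" .
    moreover have "0 < 1 + d / k" by (simp add: add_pos_nonneg)
    ultimately have "ln (1 + d / k) \<le> ln ((1 + d / x)\<^sup>2)"
      by (subst ln_le_cancel_iff) linarith+
    moreover have "0 < 1 + d / x" using assms by (simp add: add_pos_nonneg)
    ultimately show ?thesis using ln_realpow[of "1 + d / x" 2] by simp
  qed
  also have "2 * ln (1 + d / x) = 2 / x * D"
    using assms by (simp add: D_def)
  finally have a: "ln (1 + d / k) \<le> 2 / x * D" .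
  \<comment> \<open>by \<open>ln (1 + y) \<ge> y / (1 + y)\<close> with \<open>y = d / x\<close>, \<open>D\<close> is at least \<open>d * x / (d + x)\<close>\<close>
  have \<mu>D: "?\<mu> / 2 \<le> D"
  proof -
    have "- ln (1 + d / x) \<le> 1 / (1 + d / x) - 1"
      using ln_le_minus_one[of "inverse (1 + d / x)"] ln_inverse[of "1 + d / x"] assms
      by (simp only: inverse_eq_divide) (simp add: add_pos_pos)
    also have "\<dots> = - (d / (x + d))"
      using assms by (simp add: divide_simps)
    finally have "x * (d / (x + d)) \<le> D"
      unfolding D_def using assms by (intro mult_left_mono) auto
    moreover have "?\<mu> / 2 \<le> x * (d / (x + d))"
    proof (cases "real d \<le> x")
      case True
      hence "d * (x + d) \<le> d * (2 * x)" by (intro mult_left_mono) auto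
      thus ?thesis using assms True by (simp add: field_simps)
    next
      case False
      hence "x * (x + d) \<le> x * (2 * d)" using assms by (intro mult_left_mono) auto
      thus ?thesis using assms False by (simp add: field_simps)
    qed
    ultimately show ?thesis by linarith
  qed
  have "1 + ln (min d k) \<le> 1 + ln ?\<mu>"
    using assms k \<mu> by (auto simp: min_def)
  also have "\<dots> = (1 + ln ?\<mu>) / (?\<mu> / 2) * (?\<mu> / 2)"
  proof -
    have "?\<mu> \<noteq> 0" using \<mu> by linarith
    thus ?thesis by (simp only: nonzero_eq_divide_eq times_divide_eq_left)
  qed
  also have "\<dots> \<le> (1 + ln ?\<mu>) / (?\<mu> / 2) * D"
    using \<mu> \<mu>D by (intro mult_left_mono) (auto intro!: divide_nonneg_nonneg mult_nonneg_nonneg add_nonneg_nonneg)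
  finally have b: "1 + ln (min d k) \<le> (1 + ln ?\<mu>) / (?\<mu> / 2) * D" .
  have "ln (real ((d + k) choose d)) \<le> entropy d x"
    using assms by (intro ln_binomial_le_entropy) auto
  hence "\<bar>ln (real ((d + k) choose d)) - entropy d x\<bar> \<le> ln (1 + d / k) + 1 + ln (min d k)"
    using low by linarith
  also have "\<dots> \<le> 2 / x * D + (1 + ln ?\<mu>) / (?\<mu> / 2) * D"
    using a b by linarith
  finally show ?thesis by (simp add: algebra_simps)
qed

lemma ln_binomial_asymptotics:
  fixes x :: "nat \<Rightarrow> real" and k :: "nat \<Rightarrow> nat"
  assumes x: "filterlim x at_top sequentially"
    and k: "\<And>d. 1 \<le> d \<Longrightarrow> real (k d) < x d \<and> x d \<le> real (k d) + 1"
  shows "(\<lambda>d. (ln (real ((d + k d) choose d)) - entropy d (x d)) / (x d * ln (1 + d / x d)))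
           \<longlonglongrightarrow> 0"
proof (rule tendsto_0_le[where K = 1])
  have \<mu>: "filterlim (\<lambda>d. min (real d) (x d)) at_top sequentially"
    unfolding filterlim_at_top
  proof
    fix Z :: real
    have "eventually (\<lambda>d. Z \<le> real d) sequentially" "eventually (\<lambda>d. Z \<le> x d) sequentially"
      using x filterlim_real_sequentially by (auto simp: filterlim_at_top)
    thus "eventually (\<lambda>d. Z \<le> min (real d) (x d)) sequentially"
      by eventually_elim auto
  qed
  have "((\<lambda>m::real. (1 + ln m) / (m / 2)) \<longlongrightarrow> 0) at_top"
  proof -
    have "((\<lambda>m::real. (inverse m + ln m / m) * 2) \<longlongrightarrow> (0 + 0) * 2) at_top"
      by (intro tendsto_intros tendsto_inverse_0_at_top filterlim_ident ln_x_over_x_tendsto_0)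
    moreover have "eventually (\<lambda>m::real. (inverse m + ln m / m) * 2 = (1 + ln m) / (m / 2)) at_top"
      using eventually_gt_at_top[of 0] by eventually_elim (simp add: field_simps)
    ultimately show ?thesis by (auto elim: Lim_transform_eventually)
  qed
  from filterlim_compose[OF this \<mu>]
  have "(\<lambda>d. (1 + ln (min d (x d))) / (min d (x d) / 2)) \<longlonglongrightarrow> 0" .
  moreover have "(\<lambda>d. 2 / x d) \<longlonglongrightarrow> 0"
    using tendsto_divide_0[OF tendsto_const filterlim_at_top_imp_at_infinity[OF x]] .
  ultimately show "(\<lambda>d. 2 / x d + (1 + ln (min d (x d))) / (min d (x d) / 2)) \<longlonglongrightarrow> 0"
    using tendsto_add[of _ 0 sequentially _ 0] by auto
  have "eventually (\<lambda>d. 2 \<le> x d) sequentially"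
    using x by (auto simp: filterlim_at_top)
  thus "eventually (\<lambda>d. norm ((ln (real ((d + k d) choose d)) - entropy d (x d)) / (x d * ln (1 + d / x d)))
          \<le> norm (2 / x d + (1 + ln (min d (x d))) / (min d (x d) / 2)) * 1) sequentially"
    using eventually_ge_at_top[of 1]
  proof eventually_elim
    case (elim d)
    define D where "D = x d * ln (1 + d / x d)"
    have D: "0 < D" unfolding D_def using elim by (intro mult_pos_pos ln_gt_zero) auto
    define B where "B = 2 / x d + (1 + ln (min d (x d))) / (min d (x d) / 2)"
    have "\<bar>ln (real ((d + k d) choose d)) - entropy d (x d)\<bar> \<le> B * D"
      unfolding D_def B_def using elim k[of d] by (intro ln_binomial_entropy_error) auto
    hence "\<bar>ln (real ((d + k d) choose d)) - entropy d (x d)\<bar> / D \<le> B"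
      using D by (simp add: field_simps)
    hence "\<bar>ln (real ((d + k d) choose d)) - entropy d (x d)\<bar> / D \<le> \<bar>B\<bar>" by linarith
    thus ?case using D unfolding D_def[symmetric] B_def[symmetric] by simp
  qed
qed

section \<open>Asymptotics of the information complexity\<close>

theorem theorem2:
  fixes \<gamma> :: real
    and \<epsilon> :: "nat \<Rightarrow> real"
    and H :: "nat \<Rightarrow> ((nat \<Rightarrow> real) \<Rightarrow> real) set"
    and ip :: "nat \<Rightarrow> ((nat \<Rightarrow> real) \<Rightarrow> real) \<Rightarrow> ((nat \<Rightarrow> real) \<Rightarrow> real) \<Rightarrow> real"
  assumes "0 < \<gamma>"
    and "\<And>d. 1 \<le> d \<Longrightarrow> rkhs (Rd d) (gaussian_kernel \<gamma> d) (H d) (ip d)"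
    and "\<And>d. 1 \<le> d \<Longrightarrow> 0 < \<epsilon> d \<and> \<epsilon> d < 1"
    and "\<epsilon> \<longlonglongrightarrow> 0"
  shows "\<exists>R :: nat \<Rightarrow> real.
    (\<forall>d\<ge>1. ln (real (info_complexity (H d) (ip d) d (\<epsilon> d))) =
        real d * ln (1 + c_omega \<gamma> * \<bar>ln ((\<epsilon> d)\<^sup>2)\<bar> / real d)
      + c_omega \<gamma> * \<bar>ln ((\<epsilon> d)\<^sup>2)\<bar> * ln (1 + real d / (c_omega \<gamma> * \<bar>ln ((\<epsilon> d)\<^sup>2)\<bar>))
      + R d) \<and>
    (\<lambda>d. R d / (\<bar>ln ((\<epsilon> d)\<^sup>2)\<bar> * ln (1 + real d / (c_omega \<gamma> * \<bar>ln ((\<epsilon> d)\<^sup>2)\<bar>))))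
      \<longlonglongrightarrow> 0"
proof -
  let ?c = "c_omega \<gamma>"
  define x where "x = (\<lambda>d. ?c * \<bar>ln ((\<epsilon> d)\<^sup>2)\<bar>)"
  \<comment> \<open>the largest integer strictly below \<open>x d\<close>, also when \<open>x d\<close> is an integer\<close>
  define m where "m = (\<lambda>d. nat (\<lceil>x d\<rceil> - 1))"
  define R where "R = (\<lambda>d. ln (real (info_complexity (H d) (ip d) d (\<epsilon> d))) - entropy d (x d))"
  have c: "0 < ?c"
    using omega_bounds(4,5)[OF assms(1)] by (simp add: c_omega_def)
  have x_pos: "0 < x d" if "1 \<le> d" for d
  proof -
    have "(\<epsilon> d)\<^sup>2 < 1" using assms(3)[OF that] by (simp add: power_less_one_iff)
    hence "ln ((\<epsilon> d)\<^sup>2) < 0" using assms(3)[OF that] by simp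
    thus ?thesis unfolding x_def using c by (intro mult_pos_pos) auto
  qed
  have m: "real (m d) < x d \<and> x d \<le> real (m d) + 1" if "1 \<le> d" for d
  proof -
    have "0 < \<lceil>x d\<rceil>" using x_pos[OF that] by simp
    hence "real (m d) = of_int \<lceil>x d\<rceil> - 1" by (simp add: m_def)
    thus ?thesis by linarith
  qed
  have x_lim: "filterlim x at_top sequentially"
  proof -
    have "eventually (\<lambda>d. 0 < (\<epsilon> d)\<^sup>2) sequentially"
      using eventually_ge_at_top[of 1] by eventually_elim (use assms(3) in force)
    hence "filterlim (\<lambda>d. (\<epsilon> d)\<^sup>2) (at_right 0) sequentially"
      using tendsto_power[OF assms(4), of 2] by (auto intro!: filterlim_at_withinI simp: filterlim_at)
    hence "filterlim (\<lambda>d. ln ((\<epsilon> d)\<^sup>2)) at_bot sequentially"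
      by (rule filterlim_compose[OF ln_at_0])
    hence "filterlim (\<lambda>d. \<bar>ln ((\<epsilon> d)\<^sup>2)\<bar>) at_top sequentially"
      using filterlim_at_infinity_imp_norm_at_top filterlim_at_bot_imp_at_infinity by fastforce
    thus ?thesis
      unfolding x_def by (rule filterlim_tendsto_pos_mult_at_top[OF tendsto_const c])
  qed
  have complexity: "info_complexity (H d) (ip d) d (\<epsilon> d) = (d + m d) choose d" if "1 \<le> d" for d
    using assms(3)[OF that] m[OF that] that
    by (intro gaussian_info_complexity[OF assms(1) _ assms(2)[OF that]]) (auto simp: x_def)
  have "(\<lambda>d. ?c * ((ln (real ((d + m d) choose d)) - entropy d (x d)) / (x d * ln (1 + d / x d)))) \<longlonglongrightarrow> ?c * 0"
    by (intro tendsto_mult tendsto_const ln_binomial_asymptotics x_lim m)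
  moreover have "eventually (\<lambda>d. ?c * ((ln (real ((d + m d) choose d)) - entropy d (x d)) / (x d * ln (1 + d / x d))) =
      R d / (\<bar>ln ((\<epsilon> d)\<^sup>2)\<bar> * ln (1 + real d / x d))) sequentially"
    using eventually_ge_at_top[of 1]
  proof eventually_elim
    case (elim d)
    have "?c * (a / (x d * b)) = a / (\<bar>ln ((\<epsilon> d)\<^sup>2)\<bar> * b)" for a b
      using c by (simp add: x_def)
    thus ?case by (simp add: R_def complexity[OF elim])
  qed
  ultimately have "(\<lambda>d. R d / (\<bar>ln ((\<epsilon> d)\<^sup>2)\<bar> * ln (1 + real d / x d))) \<longlonglongrightarrow> 0"
    by (auto elim: Lim_transform_eventually)
  thus ?thesis
    by (intro exI[of _ R]) (simp add: R_def entropy_def x_def)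
qed

end
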